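(* Any finitely generated abelian subgroup of $\mathrm{PC}^{\bowtie}(\mathbf{S})$ is realizable.
   Context: Let $\mathbf{S}=\mathbf{R}/\mathbf{Z}$. Let $\widehat{\mathrm{PC}^{\bowtie}}(\mathbf{S})$ be the group of permutations of $\mathbf{S}$ that are continuous outside a finite subset; let $\mathfrak{S}_{\mathrm{fin}}(\mathbf{S})$ be its normal subgroup of finitely supported permutations; let $\mathrm{PC}^{\bowtie}(\mathbf{S})=\widehat{\mathrm{PC}^{\bowtie}}(\mathbf{S})/\mathfrak{S}_{\mathrm{fin}}(\mathbf{S})$ with quotient homomorphism $\pi$. A subgroup $\Gamma\subset\mathrm{PC}^{\bowtie}(\mathbf{S})$ is realizable if there is a subgroup $\Lambda$ of $\widehat{\mathrm{PC}^{\bowtie}}(\mathbf{S})$ such that $\pi$ restricts to a bijection $\Lambda\to\Gamma$. *)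

theory Defs
  imports "HOL-Algebra.Bij" "HOL-Algebra.Coset" "HOL-Algebra.Generated_Groups" Complex_Main
begin

quotient_type circle = real / "\<lambda>x y::real. x - y \<in> \<int>"
proof (rule equivpI)
  show "reflp (\<lambda>x y::real. x - y \<in> \<int>)"
    by (simp add: reflp_def)
  show "symp (\<lambda>x y::real. x - y \<in> \<int>)"
    unfolding symp_def by (metis Ints_minus minus_diff_eq)
  show "transp (\<lambda>x y::real. x - y \<in> \<int>)"
    unfolding transp_def by (metis Ints_add diff_add_cancel add_diff_eq)
qed

lemma abs_circle_eq_iff: "abs_circle x = abs_circle y \<longleftrightarrow> x - y \<in> \<int>"
  using Quotient_rel_abs[OF Quotient_circle] circle.abs_eq_iff by simp

lemma abs_circle_surj: obtains x where "p = abs_circle x"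
  by (metis Quotient_circle Quotient_abs_rep)

instantiation circle :: t2_space
begin

definition open_circle :: "circle set \<Rightarrow> bool"
  where "open_circle U \<longleftrightarrow> open (abs_circle -` U)"

instance
proof
  show "open (UNIV :: circle set)"
    by (simp add: open_circle_def)
next
  fix S T :: "circle set"
  assume "open S" "open T"
  then show "open (S \<inter> T)"
    by (simp add: open_circle_def vimage_Int open_Int)
next
  fix K :: "circle set set"
  assume "\<forall>S\<in>K. open S"
  then show "open (\<Union>K)"
    by (auto simp: open_circle_def vimage_Union)
next
  fix p q :: circle
  assume "p \<noteq> q"
  obtain a where a: "p = abs_circle a" by (rule abs_circle_surj)
  obtain b where b: "q = abs_circle b" by (rule abs_circle_surj)
  define g where "g = (\<lambda>t. cos (2 * pi * (t - a)))"
  have per: "g s = g t" if st: "s - t \<in> \<int>" for s t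
  proof -
    obtain k where "s - t = of_int k" using st unfolding Ints_def by blast
    then have "2 * pi * (s - a) = 2 * pi * (t - a) + 2 * pi * of_int k"
      by (simp add: algebra_simps flip: distrib_left)
    then show ?thesis
      unfolding g_def by (simp add: cos_add)
  qed
  have ne: "g b \<noteq> 1"
  proof
    assume "g b = 1"
    then obtain n :: int where "2 * pi * (b - a) = real_of_int n * 2 * pi"
      unfolding g_def cos_one_2pi_int by blast
    then have "b - a = of_int n" by simp
    then have "b - a \<in> \<int>" by simp
    then have "q = p" unfolding a b abs_circle_eq_iff .
    then show False using \<open>p \<noteq> q\<close> by simp
  qed
  have gb: "g b < 1" using ne cos_le_one[of "2 * pi * (b - a)"] unfolding g_def by linarith
  have cont: "continuous_on UNIV g"
    unfolding g_def by (intro continuous_intros)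
  define m where "m = (1 + g b) / 2"
  have *: "abs_circle -` (abs_circle ` {t. P (g t)}) = {t. P (g t)}" for P
  proof (intro equalityI subsetI)
    fix s assume "s \<in> abs_circle -` (abs_circle ` {t. P (g t)})"
    then obtain t where "s - t \<in> \<int>" "P (g t)" by (auto simp: abs_circle_eq_iff)
    then show "s \<in> {t. P (g t)}" using per[of s t] by simp
  qed auto
  have "open {t. m < g t}" "open {t. g t < m}"
    by (intro open_Collect_less cont continuous_on_const)+
  then have "open (abs_circle ` {t. m < g t})" "open (abs_circle ` {t. g t < m})"
    using *[of "\<lambda>u. m < u"] *[of "\<lambda>u. u < m"] by (simp_all add: open_circle_def)
  moreover have "p \<in> abs_circle ` {t. m < g t}"
    unfolding a using gb by (auto simp: m_def g_def)
  moreover have "q \<in> abs_circle ` {t. g t < m}"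
    unfolding b using gb by (auto simp: m_def)
  moreover have "abs_circle ` {t. m < g t} \<inter> abs_circle ` {t. g t < m} = {}"
  proof -
    have False if "m < g s" "g t < m" "abs_circle s = abs_circle t" for s t
      using that per[of s t] by (simp add: abs_circle_eq_iff)
    then show ?thesis by blast
  qed
  ultimately show "\<exists>U V. open U \<and> open V \<and> p \<in> U \<and> q \<in> V \<and> U \<inter> V = {}"
    by blast
qed

end

text \<open>
  No condition on the inverse is imposed: it is automatically continuous outside a finite set
  (lemma \<open>isCont_inv_circle\<close>). Finite sets being closed, continuity at every point outside
  \<open>F\<close> is the same as continuity of the restriction to the complement of \<open>F\<close>.
\<close>

definition PC_hat :: "(circle \<Rightarrow> circle) monoid"
  where "PC_hat = BijGroup UNIV
    \<lparr>carrier := {f \<in> Bij UNIV. \<exists>F. finite F \<and> (\<forall>x. x \<notin> F \<longrightarrow> isCont f x)}\<rparr>"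

definition Sym_fin :: "(circle \<Rightarrow> circle) set"
  where "Sym_fin = {f \<in> Bij UNIV. finite {x. f x \<noteq> x}}"

definition PC :: "(circle \<Rightarrow> circle) set monoid"
  where "PC = PC_hat Mod Sym_fin"

definition PC_proj :: "(circle \<Rightarrow> circle) \<Rightarrow> (circle \<Rightarrow> circle) set"
  where "PC_proj f = Sym_fin #>\<^bsub>PC_hat\<^esub> f"

definition realizable :: "(circle \<Rightarrow> circle) set set \<Rightarrow> bool"
  where "realizable \<Gamma> \<longleftrightarrow> (\<exists>\<Lambda>. subgroup \<Lambda> PC_hat \<and> bij_betw PC_proj \<Lambda> \<Gamma>)"

lemma continuous_abs_circle: "isCont abs_circle x"
  unfolding continuous_at_open open_circle_def
  by (metis vimageE vimageI)

lemma open_map_abs_circle: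
  assumes "open U" shows "open (abs_circle ` U)"
proof -
  have "abs_circle -` (abs_circle ` U) = (\<Union>k::int. (\<lambda>x. x + of_int k) -` U)"
  proof -
    have "abs_circle t \<in> abs_circle ` U \<longleftrightarrow> (\<exists>k::int. t + of_int k \<in> U)" for t
    proof
      assume "abs_circle t \<in> abs_circle ` U"
      then obtain u where "u \<in> U" "u - t \<in> \<int>"
        by (metis abs_circle_eq_iff imageE)
      then obtain k where "u - t = of_int k" unfolding Ints_def by blast
      then have "t + of_int k \<in> U" using \<open>u \<in> U\<close> by (metis add.commute diff_add_cancel)
      then show "\<exists>k::int. t + of_int k \<in> U" ..
    next
      assume "\<exists>k::int. t + of_int k \<in> U"
      then obtain k :: int where k: "t + of_int k \<in> U" ..
      have "abs_circle t = abs_circle (t + of_int k)"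
        by (simp add: abs_circle_eq_iff)
      then show "abs_circle t \<in> abs_circle ` U" using k by blast
    qed
    then show ?thesis by (simp add: set_eq_iff)
  qed
  moreover have "open ((\<lambda>x. x + of_int k) -` U)" for k :: int
    by (intro open_vimage assms continuous_intros)
  ultimately show ?thesis by (simp add: open_circle_def open_UN)
qed

lemma isCont_circle_iff:
  fixes f :: "circle \<Rightarrow> 'b::topological_space"
  shows "isCont f (abs_circle x) \<longleftrightarrow> isCont (\<lambda>t. f (abs_circle t)) x"
proof
  assume "isCont f (abs_circle x)"
  then show "isCont (\<lambda>t. f (abs_circle t)) x"
    by (rule isCont_o2[OF continuous_abs_circle])
next
  assume L: "isCont (\<lambda>t. f (abs_circle t)) x"
  show "isCont f (abs_circle x)"
    unfolding continuous_at_open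
  proof (intro allI impI)
    fix V assume "open V \<and> f (abs_circle x) \<in> V"
    then obtain U where "open U" "x \<in> U" "\<forall>t\<in>U. f (abs_circle t) \<in> V"
      using L unfolding continuous_at_open by metis
    then show "\<exists>S. open S \<and> abs_circle x \<in> S \<and> (\<forall>y\<in>S. f y \<in> V)"
      by (intro exI[of _ "abs_circle ` U"]) (auto intro: open_map_abs_circle)
  qed
qed

text \<open>The section of \<^const>\<open>abs_circle\<close> with values in \<open>[a - 1/2, a + 1/2)\<close>.\<close>

definition circle_sec :: "real \<Rightarrow> circle \<Rightarrow> real"
  where "circle_sec a p = a - 1/2 + frac (rep_circle p - a + 1/2)"

lemma abs_circle_sec [simp]: "abs_circle (circle_sec a p) = p"
proof -
  have "circle_sec a p - rep_circle p \<in> \<int>"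
    by (simp add: circle_sec_def frac_def)
  then have "abs_circle (circle_sec a p) = abs_circle (rep_circle p)"
    by (simp add: abs_circle_eq_iff)
  then show ?thesis
    by (metis Quotient_circle Quotient_abs_rep)
qed

lemma circle_sec_abs: "circle_sec a (abs_circle t) = a - 1/2 + frac (t - a + 1/2)"
proof -
  have "rep_circle (abs_circle t) - t \<in> \<int>"
    by (metis abs_circle_eq_iff Quotient_circle Quotient_abs_rep)
  then obtain k where "rep_circle (abs_circle t) - t = of_int k" unfolding Ints_def by blast
  then have "rep_circle (abs_circle t) - a + 1/2 = (t - a + 1/2) + of_int k" by simp
  then show ?thesis unfolding circle_sec_def by (simp only: frac_add_of_int_right frac_def floor_add_int) simp
qed

lemma circle_sec_near:
  assumes "\<bar>t - a\<bar> < 1/2" shows "circle_sec a (abs_circle t) = t"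
proof -
  have "frac (t - a + 1/2) = t - a + 1/2"
    using assms by (subst frac_eq) linarith
  then show ?thesis by (simp add: circle_sec_abs)
qed

lemma isCont_circle_sec:
  assumes "\<bar>t - a\<bar> < 1/2" shows "isCont (circle_sec a) (abs_circle t)"
  unfolding isCont_circle_iff
proof -
  have "\<forall>\<^sub>F s in nhds t. s \<in> {a - 1/2 <..< a + 1/2}"
    using assms by (intro eventually_nhds_in_open open_greaterThanLessThan, unfold greaterThanLessThan_iff) linarith
  then have "\<forall>\<^sub>F s in nhds t. circle_sec a (abs_circle s) = s"
    by eventually_elim (rule circle_sec_near, unfold greaterThanLessThan_iff, linarith)
  then show "isCont (\<lambda>s. circle_sec a (abs_circle s)) t"
    by (subst isCont_cong) auto
qed

lemma isCont_inv_circle: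
  fixes f :: "circle \<Rightarrow> circle"
  assumes "bij f" "finite F" "\<And>x. x \<notin> F \<Longrightarrow> isCont f x" "p \<notin> F"
  shows "isCont (inv_into UNIV f) (f p)"
proof -
  obtain a where a: "p = abs_circle a" by (rule abs_circle_surj)
  obtain b where b: "f p = abs_circle b" by (rule abs_circle_surj)
  define h where "h = (\<lambda>z. circle_sec b (f (abs_circle z)))"
  define g where "g = (\<lambda>s. circle_sec a (inv_into UNIV f (abs_circle s)))"
  define W where "W = abs_circle ` {b - 1/2 <..< b + 1/2}"
  have W: "open W" "f p \<in> W"
    unfolding W_def b by (auto intro: open_map_abs_circle)
  obtain U where U: "open U" "p \<in> U" "\<And>x. x \<in> U \<Longrightarrow> f x \<in> W"
    using assms(3)[OF assms(4)] W unfolding continuous_at_open by meson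
  define V where "V = abs_circle -` (U \<inter> - F) \<inter> {a - 1/2 <..< a + 1/2}"
  have "open (U \<inter> - F)"
    using U(1) finite_imp_closed[OF assms(2)] by (intro open_Int) (auto simp: open_Compl)
  then have "open V"
    unfolding V_def by (auto simp: open_circle_def)
  moreover have "a \<in> V"
    unfolding V_def using U(2) assms(4) a by auto
  ultimately obtain e where e: "e > 0" "\<And>z. dist z a < e \<Longrightarrow> z \<in> V"
    unfolding open_dist by blast
  have near: "z \<in> V" if "\<bar>z - a\<bar> \<le> e / 2" for z
    using that e(1) by (intro e(2)) (auto simp: dist_real_def)
  have gh: "g (h z) = z" if "z \<in> V" for z
  proof -
    have "\<bar>z - a\<bar> < 1/2" using that unfolding V_def Int_iff greaterThanLessThan_iff by linarith
    then show ?thesis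
      using bij_is_inj[OF assms(1)] by (simp add: g_def h_def circle_sec_near)
  qed
  have ch: "isCont h z" if "z \<in> V" for z
  proof -
    have z: "abs_circle z \<in> U" "abs_circle z \<notin> F" using that by (auto simp: V_def)
    obtain t where t: "f (abs_circle z) = abs_circle t" "\<bar>t - b\<bar> < 1/2"
    proof -
      obtain t where "f (abs_circle z) = abs_circle t" "t \<in> {b - 1/2 <..< b + 1/2}"
        using U(3)[OF z(1)] unfolding W_def by (rule imageE)
      moreover from this(2) have "\<bar>t - b\<bar> < 1/2"
        unfolding greaterThanLessThan_iff by linarith
      ultimately show ?thesis using that by blast
    qed
    have "isCont (\<lambda>z. f (abs_circle z)) z"
      using assms(3)[OF z(2)] by (simp add: isCont_circle_iff)
    moreover have "isCont (circle_sec b) (f (abs_circle z))"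
      unfolding t(1) by (rule isCont_circle_sec[OF t(2)])
    ultimately show ?thesis
      unfolding h_def by (rule isCont_o2)
  qed
  have ha: "h a = b"
    unfolding h_def a[symmetric] b by (rule circle_sec_near) simp
  have "isCont g (h a)"
    by (rule isCont_inverse_function[of "e / 2"]) (use e(1) gh ch near in auto)
  then have "isCont (\<lambda>s. abs_circle (g s)) b"
    unfolding ha by (rule isCont_o2[OF _ continuous_abs_circle])
  then show ?thesis
    unfolding b isCont_circle_iff by (simp add: g_def)
qed

lemma carrier_PC_hat:
  "carrier PC_hat = {f. bij f \<and> (\<exists>F. finite F \<and> (\<forall>x. x \<notin> F \<longrightarrow> isCont f x))}"
  by (auto simp: PC_hat_def Bij_def)

lemma one_PC_hat [simp]: "\<one>\<^bsub>PC_hat\<^esub> = id"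
  by (auto simp: PC_hat_def BijGroup_def)

lemma mult_BijGroup_UNIV: "bij f \<Longrightarrow> bij g \<Longrightarrow> f \<otimes>\<^bsub>BijGroup UNIV\<^esub> g = f \<circ> g"
  by (auto simp: BijGroup_def Bij_def compose_def)

lemma mult_PC_hat:
  "f \<in> carrier PC_hat \<Longrightarrow> g \<in> carrier PC_hat \<Longrightarrow> f \<otimes>\<^bsub>PC_hat\<^esub> g = f \<circ> g"
  by (auto simp: PC_hat_def BijGroup_def Bij_def compose_def)

lemma subgroup_PC_hat: "subgroup (carrier PC_hat) (BijGroup UNIV)"
proof
  show "carrier PC_hat \<subseteq> carrier (BijGroup UNIV)"
    by (auto simp: PC_hat_def BijGroup_def)
  have "id \<in> carrier PC_hat"
    by (auto simp: carrier_PC_hat)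
  then show "\<one>\<^bsub>BijGroup UNIV\<^esub> \<in> carrier PC_hat"
    by (simp add: BijGroup_def id_def restrict_UNIV)
next
  fix f g assume "f \<in> carrier PC_hat" "g \<in> carrier PC_hat"
  then obtain F G where f: "bij f" "finite F" "\<And>x. x \<notin> F \<Longrightarrow> isCont f x"
    and g: "bij g" "finite G" "\<And>x. x \<notin> G \<Longrightarrow> isCont g x"
    unfolding carrier_PC_hat by blast
  have "finite (G \<union> g -` F)"
    using f(2) g(2) bij_is_inj[OF g(1)] by (auto intro: finite_vimageI)
  moreover have "isCont (f \<circ> g) x" if "x \<notin> G \<union> g -` F" for x
    unfolding comp_def by (rule isCont_o2[where f = g]) (use that f(3) g(3) in auto)
  ultimately have "f \<circ> g \<in> carrier PC_hat"
    unfolding carrier_PC_hat using f(1) g(1) by (blast intro: bij_comp)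
  then show "f \<otimes>\<^bsub>BijGroup UNIV\<^esub> g \<in> carrier PC_hat"
    by (simp add: mult_BijGroup_UNIV f(1) g(1))
next
  fix f assume "f \<in> carrier PC_hat"
  then obtain F where f: "bij f" "finite F" "\<And>x. x \<notin> F \<Longrightarrow> isCont f x"
    unfolding carrier_PC_hat by blast
  have "isCont (inv_into UNIV f) y" if "y \<notin> f ` F" for y
  proof -
    have y: "f (inv_into UNIV f y) = y" using bij_is_surj[OF f(1)] by (rule surj_f_inv_f)
    then have "inv_into UNIV f y \<notin> F" using that by (metis image_eqI)
    then show ?thesis using isCont_inv_circle[OF f(1,2), of "inv_into UNIV f y"] f(3) y by simp
  qed
  moreover have "finite (f ` F)" using f(2) by simp
  ultimately have "inv_into UNIV f \<in> carrier PC_hat"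
    using bij_imp_bij_inv[OF f(1)] by (auto simp: carrier_PC_hat)
  then show "inv\<^bsub>BijGroup UNIV\<^esub> f \<in> carrier PC_hat"
    using f(1) by (simp add: inv_BijGroup Bij_def restrict_UNIV)
qed

lemma PC_hat_altdef: "PC_hat = BijGroup UNIV\<lparr>carrier := carrier PC_hat\<rparr>"
  by (simp add: PC_hat_def)

lemma group_PC_hat: "group PC_hat"
  by (subst PC_hat_altdef) (rule subgroup.subgroup_is_group[OF subgroup_PC_hat group_BijGroup])

lemma inv_PC_hat:
  assumes "f \<in> carrier PC_hat" shows "inv\<^bsub>PC_hat\<^esub> f = inv_into UNIV f"
proof -
  have "inv\<^bsub>PC_hat\<^esub> f = inv\<^bsub>BijGroup UNIV\<^esub> f"
    by (subst PC_hat_altdef) (rule group.m_inv_consistent[OF group_BijGroup subgroup_PC_hat assms])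
  then show ?thesis
    using assms by (simp add: inv_BijGroup carrier_PC_hat Bij_def restrict_UNIV)
qed

lemma Sym_fin_subset: "Sym_fin \<subseteq> carrier PC_hat"
proof
  fix f assume f: "f \<in> Sym_fin"
  let ?F = "{x. f x \<noteq> x}"
  have fin: "finite ?F" and "bij f" using f by (auto simp: Sym_fin_def Bij_def)
  have "isCont f x" if "x \<notin> ?F" for x
  proof -
    have "open (- ?F)" using finite_imp_closed[OF fin] by (simp only: open_Compl)
    then have "\<forall>\<^sub>F y in nhds x. y \<in> - ?F"
      using that by (intro eventually_nhds_in_open) auto
    then have "\<forall>\<^sub>F y in nhds x. f y = y" by eventually_elim simp
    then have "isCont f x = isCont (\<lambda>y. y) x" by (rule isCont_cong)
    then show ?thesis by simp
  qed
  then show "f \<in> carrier PC_hat"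
    unfolding carrier_PC_hat using fin \<open>bij f\<close> by blast
qed

lemma normal_Sym_fin: "Sym_fin \<lhd> PC_hat"
  unfolding group.normal_inv_iff[OF group_PC_hat]
proof (intro conjI ballI)
  show "subgroup Sym_fin PC_hat"
  proof
    show "Sym_fin \<subseteq> carrier PC_hat" by (rule Sym_fin_subset)
    show "\<one>\<^bsub>PC_hat\<^esub> \<in> Sym_fin" by (simp add: Sym_fin_def Bij_def)
  next
    fix f g assume fg: "f \<in> Sym_fin" "g \<in> Sym_fin"
    have "finite ({x. f x \<noteq> x} \<union> {x. g x \<noteq> x})" using fg by (simp add: Sym_fin_def)
    then have "finite {x. (f \<circ> g) x \<noteq> x}" by (rule rev_finite_subset) auto
    then have "f \<circ> g \<in> Sym_fin" using fg by (auto simp: Sym_fin_def Bij_def intro: bij_comp)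
    then show "f \<otimes>\<^bsub>PC_hat\<^esub> g \<in> Sym_fin"
      using fg Sym_fin_subset by (simp add: mult_PC_hat subset_iff)
  next
    fix f assume f: "f \<in> Sym_fin"
    then have "bij f" by (simp add: Sym_fin_def Bij_def)
    then have "{x. inv_into UNIV f x \<noteq> x} = {x. f x \<noteq> x}"
      using bij_inv_eq_iff[of f] by (intro Collect_cong) metis
    then have "inv_into UNIV f \<in> Sym_fin"
      using f by (simp add: Sym_fin_def Bij_def bij_imp_bij_inv)
    then show "inv\<^bsub>PC_hat\<^esub> f \<in> Sym_fin"
      using f Sym_fin_subset by (simp add: inv_PC_hat subset_iff)
  qed
next
  fix g h assume g: "g \<in> carrier PC_hat" and h: "h \<in> Sym_fin"
  have "bij g" "bij h" using g h by (auto simp: carrier_PC_hat Sym_fin_def Bij_def)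
  have "{x. (g \<circ> h \<circ> (inv_into UNIV g)) x \<noteq> x} \<subseteq> g ` {x. h x \<noteq> x}"
  proof
    fix x assume x: "x \<in> {x. (g \<circ> h \<circ> (inv_into UNIV g)) x \<noteq> x}"
    have "g (inv_into UNIV g x) = x" using \<open>bij g\<close> by (simp add: bij_is_surj surj_f_inv_f)
    then show "x \<in> g ` {x. h x \<noteq> x}" using x by (intro image_eqI[of _ _ "inv_into UNIV g x"]) auto
  qed
  moreover have "finite (g ` {x. h x \<noteq> x})" using h by (simp add: Sym_fin_def)
  ultimately have "finite {x. (g \<circ> h \<circ> (inv_into UNIV g)) x \<noteq> x}" by (rule finite_subset)
  then have "g \<circ> h \<circ> (inv_into UNIV g) \<in> Sym_fin"
    using \<open>bij g\<close> \<open>bij h\<close> by (auto simp: Sym_fin_def Bij_def intro!: bij_comp bij_imp_bij_inv)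
  moreover have "g \<otimes>\<^bsub>PC_hat\<^esub> h \<otimes>\<^bsub>PC_hat\<^esub> inv\<^bsub>PC_hat\<^esub> g = g \<circ> h \<circ> (inv_into UNIV g)"
  proof -
    interpret group PC_hat by (rule group_PC_hat)
    have h': "h \<in> carrier PC_hat" using h Sym_fin_subset by blast
    have "g \<otimes>\<^bsub>PC_hat\<^esub> h \<otimes>\<^bsub>PC_hat\<^esub> inv\<^bsub>PC_hat\<^esub> g = (g \<otimes>\<^bsub>PC_hat\<^esub> h) \<circ> inv\<^bsub>PC_hat\<^esub> g"
      using g h' by (intro mult_PC_hat) auto
    then show ?thesis using g h' by (simp add: mult_PC_hat inv_PC_hat)
  qed
  ultimately show "g \<otimes>\<^bsub>PC_hat\<^esub> h \<otimes>\<^bsub>PC_hat\<^esub> inv\<^bsub>PC_hat\<^esub> g \<in> Sym_fin"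
    by simp
qed

lemma group_PC: "group PC"
  unfolding PC_def by (rule normal.factorgroup_is_group[OF normal_Sym_fin])

lemma PC_proj_hom: "PC_proj \<in> hom PC_hat PC"
  unfolding PC_proj_def PC_def by (rule normal.r_coset_hom_Mod[OF normal_Sym_fin])

lemma PC_proj_surj: "PC_proj ` carrier PC_hat = carrier PC"
  by (auto simp: PC_proj_def PC_def FactGroup_def RCOSETS_def)

end

theory Submission
  imports Defs "HOL-Analysis.Analysis"
begin

text \<open>
  An element of \<open>PC_hat\<close> is locally monotone, so it acts on the set \<open>D\<close> of one-sided germs of the
  circle, i.e. on circle \<open>\<times>\<close> bool, and finitely supported permutations act trivially. Hence \<open>\<Gamma>\<close> acts
  on \<open>D\<close>. Let \<open>\<tau>\<close> exchange the two germs at a point. Each \<open>\<gamma>\<close> in \<open>\<Gamma>\<close> commutes with \<open>\<tau>\<close> outside a finite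
  set, and \<open>\<gamma> d = \<tau> d\<close> for finitely many \<open>d\<close> only, since a decreasing function has at most one fixed
  point. What remains is combinatorial: the near action on \<open>D/\<tau>\<close> has to be realized.

  Only finitely many points with a finite orbit lie in an orbit on which \<open>\<tau>\<close> is not equivariant; they
  may be ignored. On an infinite orbit some generator \<open>g\<close> is of infinite order, and
  \<open>g\<^sup>-\<^sup>n \<tau> g\<^sup>n x\<close> stabilizes for \<open>n \<longlonglongrightarrow> \<infinity>\<close> and for \<open>n \<longlonglongrightarrow> -\<infinity>\<close>. The two limits are
  equivariant involutions that move each infinite orbit to a different one, and \<open>\<tau>\<close> agrees with one
  of them at all but finitely many points. Two fixed-point-free involutions of the set of infinite
  orbits admit a 2-colouring reversed by both, and then the infinite part of \<open>D/\<tau>\<close> is, up to finitely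
  many points, the union of the orbits of one colour. Of the two colours one takes the one containing
  fewer pairs \<open>{d, \<tau> d}\<close>, so that the finitely many points left over can be fixed by the whole group.
\<close>

section \<open>Two fixed-point-free involutions\<close>

text \<open>Even words in \<open>a\<close> and \<open>b\<close> split each orbit of the group they
  generate into at most two classes, which odd words exchange. The classes could coincide only if an
  odd word had a fixed point, and conjugating it down to \<open>a\<close> or \<open>b\<close>
  excludes this. One of the two classes is then coloured.\<close>

lemma two_involutions_colouring:
  fixes a b :: "'v \<Rightarrow> 'v"
  assumes aV: "\<And>v. v \<in> V \<Longrightarrow> a v \<in> V" and bV: "\<And>v. v \<in> V \<Longrightarrow> b v \<in> V"
    and aa: "\<And>v. v \<in> V \<Longrightarrow> a (a v) = v" and bb: "\<And>v. v \<in> V \<Longrightarrow> b (b v) = v"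
    and a_ne: "\<And>v. v \<in> V \<Longrightarrow> a v \<noteq> v" and b_ne: "\<And>v. v \<in> V \<Longrightarrow> b v \<noteq> v"
  obtains c :: "'v \<Rightarrow> bool"
  where "\<And>v. v \<in> V \<Longrightarrow> c (a v) \<noteq> c v" "\<And>v. v \<in> V \<Longrightarrow> c (b v) \<noteq> c v"
proof -
  let ?p = "\<lambda>n. ((\<lambda>v. a (b v)) ^^ n)" and ?q = "\<lambda>n. ((\<lambda>v. b (a v)) ^^ n)"
  have pV: "?p n v \<in> V" and qV: "?q n v \<in> V" if "v \<in> V" for n v
    using that aV bV by (induction n) auto
  have pq: "?p (Suc n) v = a (?q n (b v))" "?q (Suc n) v = b (?p n (a v))" for n v
    by (induction n) auto
  \<comment> \<open>A word of odd length in two involutions is conjugate to one of them, so it has no fixed point.\<close>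
  have odd: "\<forall>v\<in>V. ?p n v \<noteq> b v \<and> ?q n v \<noteq> a v" for n
  proof (induction n)
    case 0
    then show ?case using a_ne b_ne by force
  next
    case (Suc n)
    have "?p (Suc n) v \<noteq> b v" if v: "v \<in> V" for v
    proof
      assume "?p (Suc n) v = b v"
      then have "?q n (b v) = a (b v)"
        unfolding pq using aa[OF qV[OF bV[OF v], of n]] by simp
      then show False using Suc bV[OF v] by blast
    qed
    moreover have "?q (Suc n) v \<noteq> a v" if v: "v \<in> V" for v
    proof
      assume "?q (Suc n) v = a v"
      then have "?p n (a v) = b (a v)"
        unfolding pq using bb[OF pV[OF aV[OF v], of n]] by simp
      then show False using Suc aV[OF v] by blast
    qed
    ultimately show ?case by blast
  qed
  \<comment> \<open>The steps are the words of length two, so the classes of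
    \<open>R\<^sup>*\<close> are the orbits of the even words.\<close>
  define R where "R = {(v, a (b v)) |v. v \<in> V} \<union> {(v, b (a v)) |v. v \<in> V}"
  have "(w, v) \<in> R" if vw: "(v, w) \<in> R" for v w
  proof -
    from vw consider "v \<in> V" "w = a (b v)" | "v \<in> V" "w = b (a v)" unfolding R_def by blast
    then show ?thesis
    proof cases
      case 1
      then have "w \<in> V" "v = b (a w)" using aV bV aa bb by simp_all
      then show ?thesis unfolding R_def by blast
    next
      case 2
      then have "w \<in> V" "v = a (b w)" using aV bV aa bb by simp_all
      then show ?thesis unfolding R_def by blast
    qed
  qed
  then have "sym (R\<^sup>*)" by (intro sym_rtrancl symI)
  then have cls: "R\<^sup>* `` {v} = R\<^sup>* `` {w}" if "(v, w) \<in> R\<^sup>*" for v w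
    using that by (meson equivI equiv_class_eq refl_rtrancl trans_rtrancl sym_def Image_singleton_iff
        rtrancl_trans subset_antisym subsetI)
  have word: "\<exists>n. w = ?p n v \<or> w = ?q n v" if "(v, w) \<in> R\<^sup>*" "v \<in> V" for v w
    using that(1)
  proof induction
    case base
    then show ?case by (metis funpow_0)
  next
    case (step y z)
    then obtain n where n: "y = ?p n v \<or> y = ?q n v" by blast
    have z: "z = a (b y) \<or> z = b (a y)" using step(2) unfolding R_def by blast
    show ?case
    proof (cases n)
      case 0
      then have "z = ?p 1 v \<or> z = ?q 1 v" using n z by auto
      then show ?thesis by blast
    next
      case (Suc m)
      have "b (a (?p (Suc m) v)) = ?p m v" "a (b (?q (Suc m) v)) = ?q m v"
        using pV[OF that(2), of m] qV[OF that(2), of m] aV bV aa bb by simp_all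
      moreover have "a (b (?p n v)) = ?p (Suc n) v" "b (a (?q n v)) = ?q (Suc n) v" by simp_all
      ultimately show ?thesis using n z Suc by metis
    qed
  qed
  have ne: "R\<^sup>* `` {a v} \<noteq> R\<^sup>* `` {v}" if v: "v \<in> V" for v
  proof
    assume "R\<^sup>* `` {a v} = R\<^sup>* `` {v}"
    then have "(v, a v) \<in> R\<^sup>*" by blast
    then obtain n where n: "a v = ?p n v \<or> a v = ?q n v" using word[OF _ v] by blast
    have "?q n v \<noteq> a v" using odd[of n] v by blast
    then have n: "a v = ?p n v" using n by simp
    then obtain m where m: "n = Suc m" using a_ne[OF v] by (cases n) auto
    have "?p m v = b (a (?p n v))" using pV[OF v, of m] aV bV aa bb m by simp
    then have "?p m v = b v" using n aa[OF v] by simp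
    then show False using odd[of m] v by blast
  qed
  have eq: "R\<^sup>* `` {b v} = R\<^sup>* `` {a v}" if v: "v \<in> V" for v
  proof -
    have "(b v, a (b (b v))) \<in> R" unfolding R_def using bV[OF v] by blast
    then have "(b v, a v) \<in> R\<^sup>*" using bb[OF v] by auto
    then show ?thesis by (rule cls)
  qed
  define c where "c v \<longleftrightarrow> R\<^sup>* `` {v} = (SOME K. K \<in> {R\<^sup>* `` {v}, R\<^sup>* `` {a v}})" for v
  have ca: "c (a v) \<noteq> c v" if v: "v \<in> V" for v
  proof -
    have "c (a v) \<longleftrightarrow> R\<^sup>* `` {a v} = (SOME K. K \<in> {R\<^sup>* `` {v}, R\<^sup>* `` {a v}})"
      unfolding c_def aa[OF v] by (simp add: insert_commute)
    moreover have "(SOME K. K \<in> {R\<^sup>* `` {v}, R\<^sup>* `` {a v}}) \<in> {R\<^sup>* `` {v}, R\<^sup>* `` {a v}}"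
      by (rule someI_ex) blast
    ultimately show ?thesis unfolding c_def[of v] using ne[OF v] by auto
  qed
  have "c (b v) = c (a v)" if v: "v \<in> V" for v
  proof -
    have "R\<^sup>* `` {a (b v)} = R\<^sup>* `` {v}"
      using eq[OF bV[OF v]] bb[OF v] by simp
    then show ?thesis unfolding c_def eq[OF v] aa[OF v] by simp
  qed
  then show thesis using ca by (intro that[of c]) auto
qed

section \<open>Near actions on a double cover\<close>

definition flip :: "'x \<times> bool \<Rightarrow> 'x \<times> bool"
  where "flip d = (fst d, \<not> snd d)"

lemma flip_flip [simp]: "flip (flip d) = d"
  by (simp add: flip_def)

lemma flip_neq [simp]: "flip d \<noteq> d"
  by (simp add: flip_def prod_eq_iff)

lemma flip_eq_iff [simp]: "flip d = flip e \<longleftrightarrow> d = e"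
  by (metis flip_flip)

lemma fst_flip [simp]: "fst (flip d) = fst d"
  by (simp add: flip_def)

definition inf_order_at :: "('d \<Rightarrow> 'd) \<Rightarrow> 'd \<Rightarrow> bool"
  where "inf_order_at g x \<longleftrightarrow> (\<forall>n>0. (g ^^ n) x \<noteq> x)"

text \<open>\<open>asymp_flip g x z\<close> says that \<open>g\<^sup>-\<^sup>n \<tau> g\<^sup>n x\<close> eventually equals \<open>z\<close>, with \<open>flip\<close> for \<open>\<tau>\<close>.\<close>

definition asymp_flip :: "('x \<times> bool \<Rightarrow> 'x \<times> bool) \<Rightarrow> 'x \<times> bool \<Rightarrow> 'x \<times> bool \<Rightarrow> bool"
  where "asymp_flip g x z \<longleftrightarrow> (\<forall>\<^sub>F n in sequentially. flip ((g ^^ n) x) = (g ^^ n) z)"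

lemma asymp_flip_sym: "asymp_flip g x z \<Longrightarrow> asymp_flip g z x"
  unfolding asymp_flip_def by (elim eventually_mono) (metis flip_flip)

lemma inj_iterates:
  assumes "bij g" "inf_order_at g x"
  shows "inj (\<lambda>n. (g ^^ n) x)"
proof -
  have "m = n" if "m \<le> n" "(g ^^ m) x = (g ^^ n) x" for m n
  proof -
    have "(g ^^ n) x = (g ^^ m) ((g ^^ (n - m)) x)"
      using that(1) by (metis comp_apply funpow_add le_add_diff_inverse)
    then have "(g ^^ (n - m)) x = x"
      using that(2) bij_is_inj[OF bij_fn[OF assms(1), of m]] by (metis injD)
    then show ?thesis using assms(2) that(1) unfolding inf_order_at_def by (metis diff_is_0_eq le_antisym not_gr_zero)
  qed
  then show ?thesis by (intro injI) (metis linear)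
qed

text \<open>Distinct iterates meet each element of \<open>A\<close> at most once. It is applied with
  \<open>A\<close> the finite set where an element of \<open>G\<close> fails to commute with
  \<open>flip\<close>, or agrees with it.\<close>

lemma eventually_iterates_avoid:
  assumes "bij g" "inf_order_at g x" "finite A"
  shows "\<forall>\<^sub>F n in sequentially. (g ^^ n) x \<notin> A"
proof -
  have "finite {n. (g ^^ n) x \<in> A}"
    using finite_vimageI[OF assms(3) inj_iterates[OF assms(1,2)]] by (simp add: vimage_def)
  then show ?thesis by (simp add: cofinite_eq_sequentially[symmetric] eventually_cofinite)
qed

lemma inf_order_at_inv:
  assumes "bij g" shows "inf_order_at (inv_into UNIV g) x \<longleftrightarrow> inf_order_at g x"
proof -
  have "(inv_into UNIV g ^^ n) x = x \<longleftrightarrow> (g ^^ n) x = x" for n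
    using bij_inv_eq_iff[OF bij_fn[OF assms, of n], of x x] inv_fn[OF assms, of n] by metis
  then show ?thesis by (simp add: inf_order_at_def)
qed

text \<open>The combinatorial shadow of an abelian group acting on germs. \<open>near\<close> comes
  from continuity outside a finite set, and \<open>flips\<close> from a decreasing function having
  at most one fixed point.\<close>

locale near_double =
  fixes G S :: "('x \<times> bool \<Rightarrow> 'x \<times> bool) set"
  assumes fin_S: "finite S" and S_Bij: "S \<subseteq> Bij UNIV"
    and G_eq: "G = generate (BijGroup UNIV) S"
    and comm: "\<And>f g x. f \<in> G \<Longrightarrow> g \<in> G \<Longrightarrow> f (g x) = g (f x)"
    and near: "\<And>f. f \<in> G \<Longrightarrow> finite {d. f (flip d) \<noteq> flip (f d)}"
    and flips: "\<And>f. f \<in> G \<Longrightarrow> finite {d. f d = flip d}"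
begin

lemma G_subgroup: "subgroup G (BijGroup UNIV)"
  unfolding G_eq by (rule group.generate_is_subgroup[OF group_BijGroup]) (use S_Bij in \<open>simp add: BijGroup_def\<close>)

lemma G_bij: "f \<in> G \<Longrightarrow> bij f"
  using subgroup.mem_carrier[OF G_subgroup] by (fastforce simp: BijGroup_def Bij_def)

lemma id_G: "id \<in> G"
  using subgroup.one_closed[OF G_subgroup] by (simp add: BijGroup_def id_def restrict_UNIV)

lemma comp_G: "f \<in> G \<Longrightarrow> g \<in> G \<Longrightarrow> f \<circ> g \<in> G"
  using subgroup.m_closed[OF G_subgroup, of f g] by (simp add: mult_BijGroup_UNIV G_bij)

lemma inv_BijGroup_UNIV: "bij f \<Longrightarrow> inv\<^bsub>BijGroup UNIV\<^esub> f = inv_into UNIV f"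
  by (simp add: inv_BijGroup Bij_def restrict_UNIV)

lemma inv_G: "f \<in> G \<Longrightarrow> inv_into UNIV f \<in> G"
  using subgroup.m_inv_closed[OF G_subgroup, of f] by (simp add: inv_BijGroup_UNIV G_bij)

lemma pow_G: "f \<in> G \<Longrightarrow> f ^^ n \<in> G"
  by (induction n) (auto intro: id_G[unfolded id_def] comp_G simp: id_def[symmetric] id_G)

lemma S_G: "S \<subseteq> G"
  unfolding G_eq by (auto intro: generate.incl)

lemma G_induct [consumes 1, case_names id gen inv comp]:
  assumes "f \<in> G" "P id" "\<And>s. s \<in> S \<Longrightarrow> P s" "\<And>s. s \<in> S \<Longrightarrow> P (inv_into UNIV s)"
    "\<And>f g. f \<in> G \<Longrightarrow> g \<in> G \<Longrightarrow> P f \<Longrightarrow> P g \<Longrightarrow> P (f \<circ> g)"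
  shows "P f"
proof -
  have "f \<in> generate (BijGroup UNIV) S" using assms(1) G_eq by simp
  then show ?thesis
  proof induction
    case one
    then show ?case using assms(2) by (simp add: BijGroup_def id_def restrict_UNIV)
  next
    case (incl h)
    then show ?case by (rule assms(3))
  next
    case (inv h)
    then show ?case using assms(4) S_G by (simp add: inv_BijGroup_UNIV G_bij subset_iff)
  next
    case (eng f g)
    then have "f \<in> G" "g \<in> G" using G_eq by auto
    then show ?case using eng assms(5)[of f g] mult_BijGroup_UNIV[of f g] G_bij by metis
  qed
qed

lemma G_inj: "f \<in> G \<Longrightarrow> f x = f y \<longleftrightarrow> x = y"
  using G_bij by (metis bij_is_inj inj_eq)

lemma G_inv_cancel: "f \<in> G \<Longrightarrow> f (inv_into UNIV f x) = x" "f \<in> G \<Longrightarrow> inv_into UNIV f (f x) = x"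
  using G_bij by (metis bij_inv_eq_iff)+

lemma inf_order_at_image:
  assumes "h \<in> G" "k \<in> G" shows "inf_order_at k (h x) \<longleftrightarrow> inf_order_at k x"
proof -
  have "(k ^^ n) (h x) = h x \<longleftrightarrow> (k ^^ n) x = x" for n
    using comm[OF pow_G[OF assms(2)] assms(1)] G_inj[OF assms(1)] by metis
  then show ?thesis by (simp add: inf_order_at_def)
qed

section \<open>Limits of \<open>flip\<close> conjugated by iterates of one element\<close>

lemma eventually_commutes:
  assumes "g \<in> G" "inf_order_at g x" "h \<in> G"
  shows "\<forall>\<^sub>F n in sequentially. h (flip ((g ^^ n) x)) = flip ((g ^^ n) (h x))"
  using eventually_iterates_avoid[OF G_bij[OF assms(1)] assms(2) near[OF assms(3)]]
  by eventually_elim (simp add: comm[OF assms(3) pow_G[OF assms(1)]])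

text \<open>Once \<open>g\<close> commutes with \<open>flip\<close> at every later iterate of
  \<open>x\<close>, pulling \<open>flip ((g ^^ n) x)\<close> back by \<open>g ^^ n\<close> gives the
  same point for all these \<open>n\<close>; \<open>z\<close> is the value at the first of them,
  \<open>N\<close>.\<close>

lemma asymp_flip_exists:
  assumes g: "g \<in> G" and x: "inf_order_at g x"
  shows "\<exists>z. asymp_flip g x z"
proof -
  obtain N where N: "\<And>n. n \<ge> N \<Longrightarrow> g (flip ((g ^^ n) x)) = flip ((g ^^ n) (g x))"
    using eventually_commutes[OF g x g] unfolding eventually_sequentially by blast
  define z where "z = inv_into UNIV (g ^^ N) (flip ((g ^^ N) x))"
  have "flip ((g ^^ n) x) = (g ^^ n) z" if "n \<ge> N" for n
    using that
  proof (induction rule: dec_induct)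
    case base
    then show ?case by (simp add: z_def G_inv_cancel pow_G g)
  next
    case (step n)
    have "flip ((g ^^ Suc n) x) = g (flip ((g ^^ n) x))"
      using N[OF step(1)] comm[OF g pow_G[OF g]] by simp
    then show ?case using step by simp
  qed
  then show ?thesis unfolding asymp_flip_def eventually_sequentially by blast
qed

lemma asymp_flip_unique:
  assumes "g \<in> G" "asymp_flip g x z" "asymp_flip g x z'"
  shows "z = z'"
proof -
  have "\<forall>\<^sub>F n in sequentially. z = z'"
    using assms(2,3) unfolding asymp_flip_def
    by eventually_elim (metis G_inj pow_G assms(1))
  then show ?thesis by simp
qed

lemma asymp_flip_image:
  assumes "g \<in> G" "inf_order_at g x" "h \<in> G" "asymp_flip g x z"
  shows "asymp_flip g (h x) (h z)"
  using assms(4) eventually_commutes[OF assms(1-3)] unfolding asymp_flip_def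
  by eventually_elim (metis comm pow_G assms(1,3))

text \<open>Far along the \<open>g\<close>-orbit \<open>h\<close> commutes with \<open>flip\<close>,
  and by commutativity stabilizers are constant along orbits. Hence a choice that depends only on
  stabilizers is the same at \<open>x\<close> and at its limit \<open>z\<close>.\<close>

lemma asymp_flip_stabilizer:
  assumes g: "g \<in> G" "inf_order_at g x" and h: "h \<in> G" and xz: "asymp_flip g x z"
  shows "h z = z \<longleftrightarrow> h x = x"
proof -
  have "\<forall>\<^sub>F n in sequentially. h z = z \<longleftrightarrow> h x = x"
    using xz eventually_commutes[OF g h] unfolding asymp_flip_def
  proof eventually_elim
    case (elim n)
    have "h z = z \<longleftrightarrow> h ((g ^^ n) z) = (g ^^ n) z"
      by (simp add: comm[OF h pow_G[OF g(1)]] G_inj[OF pow_G[OF g(1)]])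
    also have "\<dots> \<longleftrightarrow> flip ((g ^^ n) (h x)) = flip ((g ^^ n) x)"
      by (simp add: elim(1)[symmetric] elim(2))
    also have "\<dots> \<longleftrightarrow> h x = x" by (simp add: G_inj pow_G g(1))
    finally show ?case .
  qed
  then show ?thesis by simp
qed

lemma asymp_flip_inf_order_at:
  assumes "g \<in> G" "inf_order_at g x" "asymp_flip g x z" "k \<in> G"
  shows "inf_order_at k z \<longleftrightarrow> inf_order_at k x"
  unfolding inf_order_at_def using asymp_flip_stabilizer[OF assms(1,2) pow_G[OF assms(4)] assms(3)] by blast

text \<open>If \<open>h x\<close> were the limit, \<open>h\<close> would agree with
  \<open>flip\<close> at all late iterates of \<open>x\<close>, which are infinitely many points,
  against \<open>flips\<close>. This is why the limit involutions move every infinite orbit to a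
  different one.\<close>

lemma not_asymp_flip_orbit:
  assumes g: "g \<in> G" "inf_order_at g x" and h: "h \<in> G"
  shows "\<not> asymp_flip g x (h x)"
proof
  assume "asymp_flip g x (h x)"
  then have "\<forall>\<^sub>F n in sequentially. False"
    using eventually_iterates_avoid[OF G_bij[OF g(1)] g(2) flips[OF h]] unfolding asymp_flip_def
    by eventually_elim (simp add: comm[OF h pow_G[OF g(1)]])
  then show False by simp
qed

lemma asymp_flip_flip:
  assumes "\<And>n. g (flip ((g ^^ n) x)) = flip (g ((g ^^ n) x))"
  shows "asymp_flip g x (flip x)"
proof -
  have "flip ((g ^^ n) x) = (g ^^ n) (flip x)" for n
    by (induction n) (simp, metis assms comp_apply funpow.simps(2))
  then show ?thesis by (simp add: asymp_flip_def)
qed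

text \<open>These are the points with infinite orbit: distinct iterates give one direction,
  \<open>finite_orbit\<close> the other. Quantifying over the finite set \<open>S\<close> lets
  exceptional sets be finite unions.\<close>

definition Inf_pts :: "('x \<times> bool) set"
  where "Inf_pts = {x. \<exists>s\<in>S. inf_order_at s x}"

lemma Inf_pts_image: "h \<in> G \<Longrightarrow> h x \<in> Inf_pts \<longleftrightarrow> x \<in> Inf_pts"
  unfolding Inf_pts_def using inf_order_at_image S_G by blast

text \<open>By \<open>F_cong\<close> the element \<open>F x\<close> depends only on which elements
  have infinite order at \<open>x\<close>. These are the same along the orbit of \<open>x\<close>
  and at its limit, so the map \<open>p\<close> glued from the different limits is still an
  equivariant involution.\<close>

lemma asymp_flip_selector:
  assumes F: "\<And>x. x \<in> Inf_pts \<Longrightarrow> F x \<in> G" "\<And>x. x \<in> Inf_pts \<Longrightarrow> inf_order_at (F x) x"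
    and F_cong: "\<And>x z. x \<in> Inf_pts \<Longrightarrow> (\<And>k. k \<in> G \<Longrightarrow> inf_order_at k z \<longleftrightarrow> inf_order_at k x) \<Longrightarrow> F z = F x"
  obtains p where "\<And>x. x \<in> Inf_pts \<Longrightarrow> asymp_flip (F x) x (p x)"
    and "\<And>x. x \<in> Inf_pts \<Longrightarrow> p x \<in> Inf_pts" "\<And>x. x \<in> Inf_pts \<Longrightarrow> p (p x) = x"
    and "\<And>x h. x \<in> Inf_pts \<Longrightarrow> h \<in> G \<Longrightarrow> p (h x) = h (p x)"
    and "\<And>x h. x \<in> Inf_pts \<Longrightarrow> h \<in> G \<Longrightarrow> p x \<noteq> h x"
proof -
  define p where "p x = (SOME z. asymp_flip (F x) x z)" for x
  have p: "asymp_flip (F x) x (p x)" if "x \<in> Inf_pts" for x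
    unfolding p_def by (rule someI_ex) (rule asymp_flip_exists[OF F[OF that]])
  have p_eq: "p x = z" if "x \<in> Inf_pts" "asymp_flip (F x) x z" for x z
    using asymp_flip_unique[OF F(1) p] that by blast
  have io: "inf_order_at k (p x) \<longleftrightarrow> inf_order_at k x" if "x \<in> Inf_pts" "k \<in> G" for x k
    using asymp_flip_inf_order_at[OF F p] that by blast
  have pI: "p x \<in> Inf_pts" if "x \<in> Inf_pts" for x
    using that io S_G unfolding Inf_pts_def by blast
  show thesis
  proof (rule that[of p])
    show "p (p x) = x" if x: "x \<in> Inf_pts" for x
    proof (rule p_eq[OF pI[OF x]])
      have "F (p x) = F x" by (rule F_cong[OF x]) (rule io[OF x])
      then show "asymp_flip (F (p x)) (p x) x" using asymp_flip_sym[OF p[OF x]] by simp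
    qed
    show "p (h x) = h (p x)" if x: "x \<in> Inf_pts" and h: "h \<in> G" for x h
    proof (rule p_eq)
      show "h x \<in> Inf_pts" using x h by (simp add: Inf_pts_image)
      have "F (h x) = F x" by (rule F_cong[OF x]) (rule inf_order_at_image[OF h])
      then show "asymp_flip (F (h x)) (h x) (h (p x))"
        using asymp_flip_image[OF F(1)[OF x] F(2)[OF x] h p[OF x]] by simp
    qed
    show "p x \<noteq> h x" if "x \<in> Inf_pts" "h \<in> G" for x h
      using not_asymp_flip_orbit[OF F[OF that(1)] that(2)] p[OF that(1)] by metis
  qed (use p pI in auto)
qed

text \<open>
  If the forward (backward) \<open>s\<close>-orbit of \<open>x\<close> avoids the points where \<open>s\<close> (its inverse) and \<open>\<tau>\<close> do not
  commute, then \<open>\<tau> x\<close> is the limit at \<open>\<infinity>\<close> (at \<open>-\<infinity>\<close>); this bounds the points where neither holds.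
\<close>

lemma finite_both_sides_exceptional:
  assumes s: "s \<in> G" and A: "finite A" "finite B"
  shows "finite {x. inf_order_at s x \<and> (\<exists>i. (s ^^ i) x \<in> A) \<and> (\<exists>j. (inv_into UNIV s ^^ j) x \<in> B)}" (is "finite ?X")
proof -
  let ?Y = "\<lambda>a b. {x. inf_order_at s x \<and> (\<exists>i. (s ^^ i) x = a) \<and> (\<exists>j. (s ^^ j) b = x)}"
  have "finite (?Y a b)" for a b
  proof (cases "?Y a b = {}")
    case False
    then obtain x i j where x: "inf_order_at s x" "(s ^^ i) x = a" "(s ^^ j) b = x" by blast
    then have "inf_order_at s b" using inf_order_at_image[OF pow_G[OF s] s] by metis
    then have inj: "inj (\<lambda>n. (s ^^ n) b)" by (rule inj_iterates[OF G_bij[OF s]])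
    \<comment> \<open>Such a \<open>y\<close> lies on the forward orbit of \<open>b\<close>, no
      later than \<open>a\<close>, whose position \<open>i + j\<close> on this injective orbit is
      fixed.\<close>
    have "?Y a b \<subseteq> (\<lambda>n. (s ^^ n) b) ` {..i + j}"
    proof
      fix y assume "y \<in> ?Y a b"
      then obtain i' j' where y: "(s ^^ i') y = a" "(s ^^ j') b = y" by blast
      have "(s ^^ (i' + j')) b = (s ^^ (i + j)) b" using x y by (simp add: funpow_add)
      then have "i' + j' = i + j" using injD[OF inj] by blast
      then show "y \<in> (\<lambda>n. (s ^^ n) b) ` {..i + j}" using y(2) by auto
    qed
    then show ?thesis by (rule finite_subset) simp
  qed (metis finite.emptyI)
  then have "finite (\<Union>a\<in>A. \<Union>b\<in>B. ?Y a b)" using A by blast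
  moreover have "?X \<subseteq> (\<Union>a\<in>A. \<Union>b\<in>B. ?Y a b)"
  proof
    fix x assume "x \<in> ?X"
    then obtain i j where x: "inf_order_at s x" "(s ^^ i) x \<in> A" "(inv_into UNIV s ^^ j) x \<in> B" by blast
    have "(s ^^ j) ((inv_into UNIV s ^^ j) x) = x"
      using G_inv_cancel(1)[OF pow_G[OF s]] inv_fn[OF G_bij[OF s]] by metis
    then show "x \<in> (\<Union>a\<in>A. \<Union>b\<in>B. ?Y a b)" using x by blast
  qed
  ultimately show ?thesis by (rule rev_finite_subset)
qed

lemma invariant_half:
  obtains C where "C \<subseteq> Inf_pts" "\<And>f x. f \<in> G \<Longrightarrow> x \<in> C \<Longrightarrow> f x \<in> C"
    and "finite {x \<in> Inf_pts. \<not> (flip x \<in> Inf_pts \<and> (flip x \<in> C \<longleftrightarrow> x \<notin> C))}"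
proof -
  \<comment> \<open>The choice is determined by the set of generators of infinite order at
    \<open>x\<close>, as \<open>F_cong\<close> in \<open>asymp_flip_selector\<close> asks. It serves
    twice: \<open>a\<close> uses the limit along \<open>g x\<close>, \<open>b\<close> the limit
    along its inverse.\<close>
  define g where "g x = (SOME s. s \<in> S \<and> inf_order_at s x)" for x
  have gS: "g x \<in> S" and gx: "inf_order_at (g x) x" if "x \<in> Inf_pts" for x
    using someI_ex[of "\<lambda>s. s \<in> S \<and> inf_order_at s x"] that unfolding g_def Inf_pts_def by auto
  have gG: "g x \<in> G" if "x \<in> Inf_pts" for x using gS[OF that] S_G by blast
  have g_cong: "g z = g x" if "\<And>k. k \<in> G \<Longrightarrow> inf_order_at k z \<longleftrightarrow> inf_order_at k x" for x z
    unfolding g_def using that S_G by (metis subsetD)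
  obtain a where a: "\<And>x. x \<in> Inf_pts \<Longrightarrow> asymp_flip (g x) x (a x)"
      "\<And>x. x \<in> Inf_pts \<Longrightarrow> a x \<in> Inf_pts" "\<And>x. x \<in> Inf_pts \<Longrightarrow> a (a x) = x"
      "\<And>x h. x \<in> Inf_pts \<Longrightarrow> h \<in> G \<Longrightarrow> a (h x) = h (a x)"
      "\<And>x h. x \<in> Inf_pts \<Longrightarrow> h \<in> G \<Longrightarrow> a x \<noteq> h x"
    by (rule asymp_flip_selector[of g]) (use gG gx g_cong in \<open>blast+\<close>)
  have inv_g: "inv_into UNIV (g x) \<in> G" "inf_order_at (inv_into UNIV (g x)) x" if "x \<in> Inf_pts" for x
    using that gx inv_G[OF gG] inf_order_at_inv[OF G_bij[OF gG]] by simp_all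
  have inv_g_cong: "inv_into UNIV (g z) = inv_into UNIV (g x)"
    if "\<And>k. k \<in> G \<Longrightarrow> inf_order_at k z \<longleftrightarrow> inf_order_at k x" for x z
    using g_cong[OF that] by simp
  obtain b where b: "\<And>x. x \<in> Inf_pts \<Longrightarrow> asymp_flip (inv_into UNIV (g x)) x (b x)"
      "\<And>x. x \<in> Inf_pts \<Longrightarrow> b x \<in> Inf_pts" "\<And>x. x \<in> Inf_pts \<Longrightarrow> b (b x) = x"
      "\<And>x h. x \<in> Inf_pts \<Longrightarrow> h \<in> G \<Longrightarrow> b (h x) = h (b x)"
      "\<And>x h. x \<in> Inf_pts \<Longrightarrow> h \<in> G \<Longrightarrow> b x \<noteq> h x"
    by (rule asymp_flip_selector[of "\<lambda>x. inv_into UNIV (g x)"]) (use inv_g inv_g_cong in \<open>blast+\<close>)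
  define orb where "orb x = (\<lambda>h. h x) ` G" for x :: "'x \<times> bool"
  have orb_refl: "x \<in> orb x" for x unfolding orb_def using id_G by (intro image_eqI[of _ _ id]) auto
  have orb_img: "p ` orb x = orb (p x)"
    if "x \<in> Inf_pts" "\<And>x h. x \<in> Inf_pts \<Longrightarrow> h \<in> G \<Longrightarrow> p (h x) = h (p x)" for p x
    unfolding orb_def using that by (auto simp: image_image)
  have orb_eq: "orb (h x) = orb x" if h: "h \<in> G" for h x
  proof -
    have "f (h x) \<in> orb x" if "f \<in> G" for f
      unfolding orb_def by (rule image_eqI[of _ _ "f \<circ> h"]) (simp_all add: comp_G[OF that h])
    moreover have "f x \<in> orb (h x)" if f: "f \<in> G" for f
      unfolding orb_def
      by (rule image_eqI[of _ _ "f \<circ> inv_into UNIV h"]) (simp_all add: comp_G[OF f inv_G[OF h]] G_inv_cancel h)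
    ultimately have "orb (h x) \<subseteq> orb x" "orb x \<subseteq> orb (h x)"
      unfolding orb_def[of "h x"] orb_def[of x] by (simp_all add: image_subset_iff)
    then show ?thesis by (rule equalityI)
  qed
  have orb_D: "orb y \<noteq> orb x" if "\<And>h. h \<in> G \<Longrightarrow> y \<noteq> h x" for x y
    using that orb_refl[of y] unfolding orb_def by auto
  have ai: "a ` orb y = orb (a y)" if "y \<in> Inf_pts" for y
    by (rule orb_img[OF that]) (rule a(4))
  have bi: "b ` orb y = orb (b y)" if "y \<in> Inf_pts" for y
    by (rule orb_img[OF that]) (rule b(4))
  \<comment> \<open>The colouring lives on the set of orbits: \<open>a\<close> and \<open>b\<close>
    commute with \<open>G\<close>, so they act on orbits by taking images.\<close>
  have "\<exists>c :: _ \<Rightarrow> bool. \<forall>v\<in>orb ` Inf_pts. c (a ` v) \<noteq> c v \<and> c (b ` v) \<noteq> c v"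
  proof (rule two_involutions_colouring[of "orb ` Inf_pts" "image a" "image b"])
    fix v assume "v \<in> orb ` Inf_pts"
    then obtain x where x: "v = orb x" "x \<in> Inf_pts" by blast
    show "a ` v \<in> orb ` Inf_pts"
      unfolding x(1) ai[OF x(2)] by (rule imageI[OF a(2)[OF x(2)]])
    show "b ` v \<in> orb ` Inf_pts"
      unfolding x(1) bi[OF x(2)] by (rule imageI[OF b(2)[OF x(2)]])
    show "a ` (a ` v) = v"
      unfolding x(1) ai[OF x(2)] ai[OF a(2)[OF x(2)]] a(3)[OF x(2)] ..
    show "b ` (b ` v) = v"
      unfolding x(1) bi[OF x(2)] bi[OF b(2)[OF x(2)]] b(3)[OF x(2)] ..
    show "a ` v \<noteq> v"
      unfolding x(1) ai[OF x(2)] by (rule orb_D) (rule a(5)[OF x(2)])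
    show "b ` v \<noteq> v"
      unfolding x(1) bi[OF x(2)] by (rule orb_D) (rule b(5)[OF x(2)])
  next
    fix c :: "('x \<times> bool) set \<Rightarrow> bool"
    assume h: "\<And>v. v \<in> orb ` Inf_pts \<Longrightarrow> c (a ` v) \<noteq> c v" "\<And>v. v \<in> orb ` Inf_pts \<Longrightarrow> c (b ` v) \<noteq> c v"
    show "\<exists>c :: _ \<Rightarrow> bool. \<forall>v\<in>orb ` Inf_pts. c (a ` v) \<noteq> c v \<and> c (b ` v) \<noteq> c v"
      by (intro exI[of _ c] ballI conjI h)
  qed
  then obtain c :: "_ \<Rightarrow> bool" where c: "\<forall>v\<in>orb ` Inf_pts. c (a ` v) \<noteq> c v \<and> c (b ` v) \<noteq> c v" ..
  define C where "C = {x \<in> Inf_pts. c (orb x)}"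
  have Ca: "a x \<in> C \<longleftrightarrow> x \<notin> C" and Cb: "b x \<in> C \<longleftrightarrow> x \<notin> C" if x: "x \<in> Inf_pts" for x
  proof -
    have "c (orb (a x)) \<noteq> c (orb x)" "c (orb (b x)) \<noteq> c (orb x)"
      using bspec[OF c imageI[OF x]] unfolding ai[OF x] bi[OF x] by (rule conjunct1, rule conjunct2)
    then show "a x \<in> C \<longleftrightarrow> x \<notin> C" "b x \<in> C \<longleftrightarrow> x \<notin> C"
      unfolding C_def using x a(2)[OF x] b(2)[OF x] by (simp_all only: mem_Collect_eq) auto
  qed
  let ?bad = "\<lambda>f. {d. f (flip d) \<noteq> flip (f d)}"
  let ?X = "\<lambda>s. {x. inf_order_at s x \<and> (\<exists>i. (s ^^ i) x \<in> ?bad s) \<and> (\<exists>j. (inv_into UNIV s ^^ j) x \<in> ?bad (inv_into UNIV s))}"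
  have "{x \<in> Inf_pts. \<not> (flip x \<in> Inf_pts \<and> (flip x \<in> C \<longleftrightarrow> x \<notin> C))} \<subseteq> (\<Union>s\<in>S. ?X s)"
  proof
    fix x assume "x \<in> {x \<in> Inf_pts. \<not> (flip x \<in> Inf_pts \<and> (flip x \<in> C \<longleftrightarrow> x \<notin> C))}"
    then have x: "x \<in> Inf_pts" and bad: "\<not> (flip x \<in> Inf_pts \<and> (flip x \<in> C \<longleftrightarrow> x \<notin> C))" by auto
    \<comment> \<open>If the forward orbit avoids the exceptional set of \<open>g x\<close>, then
      \<open>flip x\<close> is \<open>a x\<close>, which lies in \<open>Inf_pts\<close> and has the
      other colour. The same argument with \<open>b\<close> treats the backward orbit.\<close>
    have "\<exists>i. (g x ^^ i) x \<in> ?bad (g x)"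
    proof (rule ccontr)
      assume "\<not> ?thesis"
      then have "asymp_flip (g x) x (flip x)" by (intro asymp_flip_flip) auto
      then have "flip x = a x" using asymp_flip_unique[OF gG[OF x]] a(1)[OF x] by blast
      then show False using bad a(2)[OF x] Ca[OF x] by simp
    qed
    moreover have "\<exists>i. (inv_into UNIV (g x) ^^ i) x \<in> ?bad (inv_into UNIV (g x))"
    proof (rule ccontr)
      assume "\<not> ?thesis"
      then have "asymp_flip (inv_into UNIV (g x)) x (flip x)" by (intro asymp_flip_flip) auto
      then have "flip x = b x" using asymp_flip_unique[OF inv_G[OF gG[OF x]]] b(1)[OF x] by blast
      then show False using bad b(2)[OF x] Cb[OF x] by simp
    qed
    ultimately have "x \<in> ?X (g x)" by (intro CollectI conjI gx[OF x])
    then show "x \<in> (\<Union>s\<in>S. ?X s)" by (rule UN_I[OF gS[OF x]])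
  qed
  moreover have "finite (?X s)" if "s \<in> S" for s
  proof (rule finite_both_sides_exceptional)
    show "s \<in> G" using that S_G by blast
    then show "finite (?bad s)" "finite (?bad (inv_into UNIV s))" by (simp_all only: near inv_G)
  qed
  then have "finite (\<Union>s\<in>S. ?X s)" using fin_S by (intro finite_UN_I)
  ultimately have "finite {x \<in> Inf_pts. \<not> (flip x \<in> Inf_pts \<and> (flip x \<in> C \<longleftrightarrow> x \<notin> C))}"
    by (rule finite_subset)
  then show thesis
    by (intro that[of C]) (auto simp: C_def Inf_pts_image orb_eq)
qed

end

section \<open>Finite orbits, and the chart that realizes the near action\<close>

context near_double
begin

text \<open>Generators are added one at a time. Each has finite order at the points of the finite
  set reached so far, and by commutativity saturating under it preserves invariance under the
  earlier ones.\<close>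

lemma finite_orbit:
  assumes "x \<notin> Inf_pts"
  shows "finite ((\<lambda>f. f x) ` G)"
proof -
  have "\<exists>Y. finite Y \<and> x \<in> Y \<and> Y \<inter> Inf_pts = {} \<and> (\<forall>s\<in>T. s ` Y \<subseteq> Y)" if "T \<subseteq> S" for T
    using finite_subset[OF that fin_S] that
  proof (induction T rule: finite_induct)
    case empty
    then show ?case using assms by (intro exI[of _ "{x}"]) simp
  next
    case (insert t T)
    then have "T \<subseteq> S" by simp
    from insert.IH[OF this] obtain Y where Y: "finite Y" "x \<in> Y" "Y \<inter> Inf_pts = {}" "\<forall>s\<in>T. s ` Y \<subseteq> Y"
      by (elim exE conjE)
    have tS: "t \<in> S" using insert.prems by blast
    then have t: "t \<in> G" using S_G by blast
    let ?Z = "\<Union>y\<in>Y. range (\<lambda>k. (t ^^ k) y)"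
    have "finite (range (\<lambda>k. (t ^^ k) y))" if "y \<in> Y" for y
    proof -
      have "\<not> inf_order_at t y" using that Y(3) tS unfolding Inf_pts_def by blast
      then obtain n where n: "n > 0" "(t ^^ n) y = y" unfolding inf_order_at_def by blast
      have "range (\<lambda>k. (t ^^ k) y) \<subseteq> (\<lambda>k. (t ^^ k) y) ` {..<n}"
      proof (rule image_subsetI)
        fix k
        have "(t ^^ k) y = (t ^^ (k mod n)) y" using funpow_mod_eq[OF n(2)] by simp
        then show "(t ^^ k) y \<in> (\<lambda>k. (t ^^ k) y) ` {..<n}" using n(1) by simp
      qed
      then show ?thesis by (rule finite_subset) simp
    qed
    then have "finite ?Z" using Y(1) by blast
    moreover have "x \<in> ?Z" using Y(2) by (intro UN_I[of x] range_eqI[of _ _ 0]) simp_all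
    moreover have "?Z \<inter> Inf_pts = {}" using Y(3) Inf_pts_image[OF pow_G[OF t]] by auto
    moreover have "s ` ?Z \<subseteq> ?Z" if s: "s \<in> insert t T" for s
    proof (rule image_subsetI)
      fix z assume "z \<in> ?Z"
      then obtain y k where y: "y \<in> Y" "z = (t ^^ k) y" by blast
      show "s z \<in> ?Z"
      proof (cases "s = t")
        case True
        then show ?thesis using y by (intro UN_I[of y] range_eqI[of _ _ "Suc k"]) simp_all
      next
        case False
        then have sT: "s \<in> T" using s by simp
        then have "s \<in> G" using insert.prems S_G by blast
        then have "s z = (t ^^ k) (s y)" using y(2) comm pow_G[OF t] by simp
        then show ?thesis using bspec[OF Y(4) sT] y(1) by blast
      qed
    qed
    ultimately show ?case by (intro exI[of _ ?Z] conjI ballI)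
  qed
  from this[OF order_refl] obtain Y where Y: "finite Y" "x \<in> Y" "\<forall>s\<in>S. s ` Y \<subseteq> Y"
    by (elim exE conjE)
  \<comment> \<open>Equality, unlike inclusion, passes to inverses; it holds for generators because
    an injective self-map of a finite set is onto.\<close>
  have "f ` Y = Y" if "f \<in> G" for f
    using that
  proof (induction rule: G_induct)
    case (gen s)
    then have "inj_on s Y" using S_G G_inj by (intro inj_onI) blast
    then show ?case using Y(1) bspec[OF Y(3) gen] by (intro endo_inj_surj)
  next
    case (inv s)
    then have s: "s \<in> G" using S_G by blast
    have "inj_on s Y" using G_inj[OF s] by (intro inj_onI) blast
    then have "s ` Y = Y" using Y(1) bspec[OF Y(3) inv] by (intro endo_inj_surj)
    then have "inv_into UNIV s ` Y = inv_into UNIV s ` s ` Y" by simp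
    then show ?case by (simp add: image_image G_inv_cancel[OF s])
  next
    case (comp f g)
    then show ?case by (simp only: image_comp[symmetric])
  qed simp
  then have "(\<lambda>f. f x) ` G \<subseteq> Y" using Y(2) by blast
  then show ?thesis using Y(1) by (rule finite_subset)
qed

text \<open>Here the action descends to base points without error. The condition ranges over all of
  \<open>G\<close> so that it is inherited along orbits.\<close>

definition Equi_pts :: "('x \<times> bool) set"
  where "Equi_pts = {x. x \<notin> Inf_pts \<and> (\<forall>f\<in>G. f (flip x) = flip (f x))}"

lemma Equi_pts_image: "x \<in> Equi_pts \<Longrightarrow> h \<in> G \<Longrightarrow> h x \<in> Equi_pts"
proof -
  assume x: "x \<in> Equi_pts" and h: "h \<in> G"
  have "f (flip (h x)) = flip (f (h x))" if f: "f \<in> G" for f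
  proof -
    have "flip (h x) = h (flip x)" using x h by (simp add: Equi_pts_def)
    moreover have "(f \<circ> h) (flip x) = flip ((f \<circ> h) x)" using x comp_G[OF f h] unfolding Equi_pts_def by blast
    ultimately show ?thesis by simp
  qed
  then show "h x \<in> Equi_pts" using x h by (simp add: Equi_pts_def Inf_pts_image)
qed

lemma Equi_pts_flip: 
  assumes "x \<in> Equi_pts" shows "flip x \<in> Equi_pts"
proof -
  have "(s ^^ n) (flip x) = flip x \<longleftrightarrow> (s ^^ n) x = x" if "s \<in> S" for s n
  proof -
    have "s ^^ n \<in> G" using that S_G by (intro pow_G) blast
    then have "(s ^^ n) (flip x) = flip ((s ^^ n) x)" using assms by (simp add: Equi_pts_def)
    then show ?thesis by simp
  qed
  then have "inf_order_at s (flip x) \<longleftrightarrow> inf_order_at s x" if "s \<in> S" for s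
    using that by (simp add: inf_order_at_def)
  then show ?thesis using assms by (auto simp: Equi_pts_def Inf_pts_def)
qed

text \<open>If the orbit of \<open>x\<close> meets no exceptional point of a generator or its
  inverse, induction on words makes all of \<open>G\<close> commute with \<open>flip\<close> along
  it. The other points outside \<open>Inf_pts\<close> lie in the orbits of finitely many exceptional
  points, and these orbits are finite.\<close>

lemma finite_not_Equi_pts: "finite {x. x \<notin> Inf_pts \<and> x \<notin> Equi_pts}"
proof -
  let ?B = "(\<Union>s\<in>S. {d. s (flip d) \<noteq> flip (s d)} \<union> {d. inv_into UNIV s (flip d) \<noteq> flip (inv_into UNIV s d)}) - Inf_pts"
  have "{x. x \<notin> Inf_pts \<and> x \<notin> Equi_pts} \<subseteq> (\<Union>b\<in>?B. (\<lambda>f. f b) ` G)"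
  proof
    fix x assume "x \<in> {x. x \<notin> Inf_pts \<and> x \<notin> Equi_pts}"
    then have x: "x \<notin> Inf_pts" "x \<notin> Equi_pts" by auto
    have "\<exists>h\<in>G. h x \<in> ?B"
    proof (rule ccontr)
      assume neg: "\<not> ?thesis"
      have orb: "h x \<notin> Inf_pts" if "h \<in> G" for h using x(1) that by (simp add: Inf_pts_image)
      \<comment> \<open>The claim covers the whole orbit, since in a composition the left factor
        acts at a point already moved.\<close>
      have "\<forall>h\<in>G. f (flip (h x)) = flip (f (h x))" if "f \<in> G" for f
        using that
      proof (induction rule: G_induct)
        case (gen s)
        then show ?case using neg orb by blast
      next
        case (inv s)
        then show ?case using neg orb by blast
      next
        case (comp f g)
        show ?case
        proof
          fix h assume h: "h \<in> G"
          have "f (g (flip (h x))) = f (flip ((g \<circ> h) x))" using comp(4) h by simp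
          also have "\<dots> = flip (f ((g \<circ> h) x))" using comp(3) comp_G[OF comp(2) h] by blast
          finally show "(f \<circ> g) (flip (h x)) = flip ((f \<circ> g) (h x))" by simp
        qed
      qed simp
      then have "f (flip x) = flip (f x)" if "f \<in> G" for f using that id_G by fastforce
      then show False using x by (simp add: Equi_pts_def)
    qed
    then obtain h where h: "h \<in> G" "h x \<in> ?B" by blast
    have "x = inv_into UNIV h (h x)" by (simp add: G_inv_cancel h)
    then have "x \<in> (\<lambda>f. f (h x)) ` G" using inv_G[OF h(1)] by blast
    then show "x \<in> (\<Union>b\<in>?B. (\<lambda>f. f b) ` G)" using h(2) by (intro UN_I)
  qed
  moreover have "finite ?B"
    using S_G near inv_G fin_S by (intro finite_Diff finite_UN_I finite_UnI) auto
  then have "finite (\<Union>b\<in>?B. (\<lambda>f. f b) ` G)" 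
    by (intro finite_UN_I finite_orbit) auto
  ultimately show ?thesis by (rule finite_subset)
qed

text \<open>The complement of \<open>C\<close> in \<open>Inf_pts\<close> has the same three
  properties, so the half with fewer full pairs can be taken. The inequality gives the room needed
  in \<open>chart\<close>.\<close>

lemma balanced_half:
  obtains C where "C \<subseteq> Inf_pts" "\<And>f x. f \<in> G \<Longrightarrow> x \<in> C \<Longrightarrow> f x \<in> C"
    and "finite {x \<in> Inf_pts. \<not> (flip x \<in> Inf_pts \<and> (flip x \<in> C \<longleftrightarrow> x \<notin> C))}"
    and "card {p. \<forall>b. (p, b) \<in> C} \<le> card {p. \<forall>b. (p, b) \<in> Inf_pts - C}"
proof -
  obtain C where C: "C \<subseteq> Inf_pts" "\<And>f x. f \<in> G \<Longrightarrow> x \<in> C \<Longrightarrow> f x \<in> C"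
    "finite {x \<in> Inf_pts. \<not> (flip x \<in> Inf_pts \<and> (flip x \<in> C \<longleftrightarrow> x \<notin> C))}"
    by (rule invariant_half) blast
  show thesis
  proof (cases "card {p. \<forall>b. (p, b) \<in> C} \<le> card {p. \<forall>b. (p, b) \<in> Inf_pts - C}")
    case True
    with C show thesis by (rule that)
  next
    case False
    have eq: "Inf_pts - (Inf_pts - C) = C" using C(1) by blast
    show thesis
    proof (rule that[of "Inf_pts - C"])
      show "f x \<in> Inf_pts - C" if "f \<in> G" "x \<in> Inf_pts - C" for f x
      proof -
        have "x \<in> C" if "f x \<in> C"
          using C(2)[OF inv_G[OF \<open>f \<in> G\<close>] that] by (simp add: G_inv_cancel \<open>f \<in> G\<close>)
        then show ?thesis using that Inf_pts_image by blast
      qed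
      show "finite {x \<in> Inf_pts. \<not> (flip x \<in> Inf_pts \<and> (flip x \<in> Inf_pts - C \<longleftrightarrow> x \<notin> Inf_pts - C))}"
        by (rule finite_subset[OF _ C(3)]) auto
      show "card {p. \<forall>b. (p, b) \<in> Inf_pts - C} \<le> card {p. \<forall>b. (p, b) \<in> Inf_pts - (Inf_pts - C)}"
        unfolding eq using False by linarith
    qed blast
  qed
qed

text \<open>Ideally \<open>C\<close> has one germ over each base point and \<open>\<phi>\<close> is
  \<open>fst\<close>. Where both germs lie in \<open>C\<close>, one is relocated to a point of
  \<open>?M\<close>, both of whose germs lie in \<open>Inf_pts - C\<close>;
  \<open>balanced_half\<close> ensures that there are enough of these.\<close>

lemma chart:
  obtains C \<phi> where "\<And>f x. f \<in> G \<Longrightarrow> x \<in> C \<Longrightarrow> f x \<in> C" "inj_on \<phi> C"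
    and "finite {x \<in> C. \<phi> x \<noteq> fst x}"
    and "\<And>x. x \<in> C \<Longrightarrow> (\<phi> x, True) \<notin> Equi_pts"
    and "finite {p. (p, True) \<notin> Equi_pts \<and> p \<notin> \<phi> ` C}"
proof -
  obtain C where C: "C \<subseteq> Inf_pts" "\<And>f x. f \<in> G \<Longrightarrow> x \<in> C \<Longrightarrow> f x \<in> C"
    "finite {x \<in> Inf_pts. \<not> (flip x \<in> Inf_pts \<and> (flip x \<in> C \<longleftrightarrow> x \<notin> C))}" (is "finite ?X")
    and le: "card {p. \<forall>b. (p, b) \<in> C} \<le> card {p. \<forall>b. (p, b) \<in> Inf_pts - C}" (is "card ?A \<le> card ?M")
    by (rule balanced_half) blast
  have X_I: "p \<in> fst ` ?X" if "(p, b) \<in> Inf_pts" "(p, \<not> b) \<in> Inf_pts \<longrightarrow> ((p, b) \<in> C \<longleftrightarrow> (p, \<not> b) \<in> C)" for p b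
    by (rule image_eqI[of _ _ "(p, b)"]) (use that in \<open>auto simp: flip_def\<close>)
  have "?A \<subseteq> fst ` ?X"
  proof
    fix p assume "p \<in> ?A"
    then have "(p, True) \<in> C" "(p, False) \<in> C" by auto
    then show "p \<in> fst ` ?X" using C(1) by (intro X_I[of p True]) auto
  qed
  then have finA: "finite ?A" using C(3) finite_subset by blast
  have "?M \<subseteq> fst ` ?X"
  proof
    fix p assume "p \<in> ?M"
    then have "(p, True) \<in> Inf_pts - C" "(p, False) \<in> Inf_pts - C" by auto
    then show "p \<in> fst ` ?X" by (intro X_I[of p True]) auto
  qed
  then have finM: "finite ?M" using C(3) finite_subset by blast
  obtain j where j: "inj_on j ?A" "j ` ?A \<subseteq> ?M"
    using le finA finM by (meson inj_on_iff_card_le)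
  \<comment> \<open>When both germs at a point lie in \<open>C\<close>, the left one is sent to a point with no germ in \<open>C\<close>.\<close>
  define \<phi> where "\<phi> x = (if fst x \<in> ?A \<and> \<not> snd x then j (fst x) else fst x)" for x
  show thesis
  proof (rule that[of C \<phi>])
    have jM: "(j p, b) \<in> Inf_pts - C" if "p \<in> ?A" for p b using j(2) that by blast
    show "inj_on \<phi> C"
    proof (rule inj_onI)
      fix x y assume xy: "x \<in> C" "y \<in> C" "\<phi> x = \<phi> y"
      have fstj: "fst z \<noteq> j p" if "z \<in> C" "p \<in> ?A" for z p
        using jM[OF that(2), of "snd z"] that(1) by (metis DiffD2 prod.collapse)
      have snd_eq: "fst z \<in> ?A \<or> snd z = snd w" if "z \<in> C" "w \<in> C" "fst z = fst w" for z w
      proof (rule disjCI)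
        assume "snd z \<noteq> snd w"
        then have "w = (fst z, \<not> snd z)" using that(3) by (simp add: prod_eq_iff)
        then have "(fst z, snd z) \<in> C" "(fst z, \<not> snd z) \<in> C" using that(1,2) by simp_all
        then have "(fst z, b') \<in> C" for b' by (cases "b' = snd z") auto
        then show "fst z \<in> ?A" by blast
      qed
      consider "fst x \<in> ?A" "\<not> snd x" "fst y \<in> ?A" "\<not> snd y" | "\<phi> x = fst x" "\<phi> y = fst y"
        using xy fstj[of x "fst y"] fstj[of y "fst x"] unfolding \<phi>_def by (metis (no_types, lifting))
      then show "x = y"
      proof cases
        case 1
        then have "j (fst x) = j (fst y)" using xy(3) by (simp add: \<phi>_def)
        then have "fst x = fst y" using inj_onD[OF j(1)] 1 by blast
        then show ?thesis using 1 by (simp add: prod_eq_iff)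
      next
        case 2
        then have f: "fst x = fst y" using xy(3) by simp
        have "snd x = snd y"
        proof (cases "fst x \<in> ?A")
          case True
          have "snd x" using 2(1) True fstj[OF xy(1) True] unfolding \<phi>_def by metis
          moreover have "snd y" using 2(2) True fstj[OF xy(2) True] f unfolding \<phi>_def by metis
          ultimately show ?thesis by simp
        next
          case False
          then show ?thesis using snd_eq[OF xy(1,2) f] by blast
        qed
        then show ?thesis using f by (simp add: prod_eq_iff)
      qed
    qed
    have "{x \<in> C. \<phi> x \<noteq> fst x} \<subseteq> ?A \<times> UNIV" by (auto simp: \<phi>_def)
    then show "finite {x \<in> C. \<phi> x \<noteq> fst x}" by (rule finite_subset) (simp add: finA)
    show "(\<phi> x, True) \<notin> Equi_pts" if x: "x \<in> C" for x
    proof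
      assume "(\<phi> x, True) \<in> Equi_pts"
      moreover from this have "(\<phi> x, False) \<in> Equi_pts" using Equi_pts_flip by (fastforce simp: flip_def)
      ultimately have *: "(\<phi> x, b) \<notin> Inf_pts" for b by (cases b) (auto simp: Equi_pts_def)
      show False
      proof (cases "fst x \<in> ?A \<and> \<not> snd x")
        case True
        then show False using jM[of "fst x" True] * by (simp add: \<phi>_def)
      next
        case False
        then have "\<phi> x = fst x" unfolding \<phi>_def by (rule if_not_P)
        then show False using *[of "snd x"] x C(1) by auto
      qed
    qed
    have "{p. (p, True) \<notin> Equi_pts \<and> p \<notin> \<phi> ` C} \<subseteq> fst ` ?X \<union> fst ` {x. x \<notin> Inf_pts \<and> x \<notin> Equi_pts}"
    proof
      fix p assume "p \<in> {p. (p, True) \<notin> Equi_pts \<and> p \<notin> \<phi> ` C}"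
      then have p: "(p, True) \<notin> Equi_pts" "p \<notin> \<phi> ` C" by auto
      have T: "(p, True) \<notin> C"
      proof
        assume "(p, True) \<in> C"
        moreover have "p = \<phi> (p, True)" by (simp add: \<phi>_def)
        ultimately show False using p(2) by blast
      qed
      have F: "(p, False) \<notin> C"
      proof
        assume "(p, False) \<in> C"
        moreover have "p = \<phi> (p, False)" using T by (auto simp: \<phi>_def)
        ultimately show False using p(2) by blast
      qed
      show "p \<in> fst ` ?X \<union> fst ` {x. x \<notin> Inf_pts \<and> x \<notin> Equi_pts}"
      proof (cases "(p, True) \<in> Inf_pts")
        case True
        then have "p \<in> fst ` ?X" using T F by (intro X_I[of p True]) auto
        then show ?thesis by blast
      next
        case False
        then have "(p, True) \<in> {x. x \<notin> Inf_pts \<and> x \<notin> Equi_pts}" using p by blast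
        then have "p \<in> fst ` {x. x \<notin> Inf_pts \<and> x \<notin> Equi_pts}" by (rule image_eqI[rotated]) simp
        then show ?thesis by blast
      qed
    qed
    then show "finite {p. (p, True) \<notin> Equi_pts \<and> p \<notin> \<phi> ` C}"
      by (rule finite_subset) (intro finite_UnI finite_imageI C(3) finite_not_Equi_pts)
  qed (use C(2) in blast)
qed

text \<open>The base splits into three invariant pieces: over \<open>Equi_pts\<close> the action
  descends through \<open>fst\<close>, on the image of \<open>\<phi>\<close> it is transported from
  \<open>C\<close>, and the finitely many remaining points are fixed. Each piece carries a genuine
  action, hence so does the union.\<close>

theorem near_double_realization:
  obtains \<rho> where "\<And>f. f \<in> G \<Longrightarrow> bij (\<rho> f)" "\<And>f g. f \<in> G \<Longrightarrow> g \<in> G \<Longrightarrow> \<rho> (f \<circ> g) = \<rho> f \<circ> \<rho> g"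
    and "\<And>f. f \<in> G \<Longrightarrow> finite {p. \<rho> f p \<noteq> fst (f (p, True))}"
proof -
  obtain C \<phi> where C: "\<And>f x. f \<in> G \<Longrightarrow> x \<in> C \<Longrightarrow> f x \<in> C" and inj: "inj_on \<phi> C"
    and fin1: "finite {x \<in> C. \<phi> x \<noteq> fst x}" and ng: "\<And>x. x \<in> C \<Longrightarrow> (\<phi> x, True) \<notin> Equi_pts"
    and fin2: "finite {p. (p, True) \<notin> Equi_pts \<and> p \<notin> \<phi> ` C}"
    by (rule chart) blast
  define \<rho> where "\<rho> f p = (if (p, True) \<in> Equi_pts then fst (f (p, True))
     else if p \<in> \<phi> ` C then \<phi> (f (inv_into C \<phi> p)) else p)" for f p
  have fst_True: "fst (f (p, b)) = fst (f (p, True))" if "(p, True) \<in> Equi_pts" "f \<in> G" for f p b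
  proof (cases b)
    case False
    have "f (flip (p, True)) = flip (f (p, True))" using that by (simp add: Equi_pts_def)
    then have "f (p, False) = flip (f (p, True))" by (simp add: flip_def)
    then show ?thesis using False by simp
  qed simp
  have Equi_fst: "(p, b) \<in> Equi_pts \<Longrightarrow> (p, True) \<in> Equi_pts" for p b
    using Equi_pts_flip[of "(p, b)"] by (cases b) (auto simp: flip_def)
  have rho_equi: "\<rho> f p = fst (f (p, True))" if "(p, True) \<in> Equi_pts" for f p
    using that by (simp add: \<rho>_def)
  have rho_phi: "\<rho> f (\<phi> x) = \<phi> (f x)" if "x \<in> C" for f x
    using ng[OF that] that inj by (simp add: \<rho>_def)
  have rho_other: "\<rho> f p = p" if "(p, True) \<notin> Equi_pts" "p \<notin> \<phi> ` C" for f p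
    using that by (simp add: \<rho>_def)
  have comp: "\<rho> (f \<circ> g) = \<rho> f \<circ> \<rho> g" if fg: "f \<in> G" "g \<in> G" for f g
  proof
    fix p
    consider "(p, True) \<in> Equi_pts" | x where "x \<in> C" "p = \<phi> x" | "(p, True) \<notin> Equi_pts" "p \<notin> \<phi> ` C" by blast
    then show "\<rho> (f \<circ> g) p = (\<rho> f \<circ> \<rho> g) p"
    proof cases
      case 1
      obtain q b where q: "g (p, True) = (q, b)" by fastforce
      then have "(q, True) \<in> Equi_pts" using Equi_pts_image[OF 1 fg(2)] Equi_fst by metis
      then show ?thesis using 1 q fst_True[of q f b, OF _ fg(1)] by (simp add: rho_equi)
    next
      case 2
      then show ?thesis using C[OF fg(2)] by (simp add: rho_phi)
    next
      case 3
      then show ?thesis by (simp add: rho_other)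
    qed
  qed
  have rho_id: "\<rho> id = id"
  proof
    fix p show "\<rho> id p = id p"
      using inj by (auto simp: \<rho>_def)
  qed
  show thesis
  proof (rule that[of \<rho>])
    show "bij (\<rho> f)" if f: "f \<in> G" for f
    proof -
      have "f \<circ> inv_into UNIV f = id" "inv_into UNIV f \<circ> f = id" using G_inv_cancel[OF f] by auto
      then have "\<rho> f \<circ> \<rho> (inv_into UNIV f) = id" "\<rho> (inv_into UNIV f) \<circ> \<rho> f = id"
        using comp[OF f inv_G[OF f]] comp[OF inv_G[OF f] f] rho_id by simp_all
      then show ?thesis using o_bij by blast
    qed
    show "finite {p. \<rho> f p \<noteq> fst (f (p, True))}" if f: "f \<in> G" for f
    proof -
      let ?E = "{x \<in> C. \<phi> x \<noteq> fst x}"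
      \<comment> \<open>Besides the leftover points, these are the \<open>\<phi> x\<close> where
        \<open>\<phi>\<close> differs from \<open>fst\<close> at \<open>x\<close> or at
        \<open>f x\<close>, or \<open>f\<close> does not commute with \<open>flip\<close> at
        \<open>x\<close>. The last case matters because the germ in \<open>C\<close> may be
        \<open>(p, False)\<close>, whereas the claim concerns \<open>(p, True)\<close>.\<close>
      let ?P = "{p. (p, True) \<notin> Equi_pts \<and> p \<notin> \<phi> ` C} \<union> \<phi> ` (?E \<union> f -` ?E \<union> {d. f (flip d) \<noteq> flip (f d)})"
      have "{p. \<rho> f p \<noteq> fst (f (p, True))} \<subseteq> ?P"
      proof (rule subsetI, rule ccontr)
        fix p assume neq: "p \<in> {p. \<rho> f p \<noteq> fst (f (p, True))}" and "p \<notin> ?P"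
        then have "(p, True) \<notin> Equi_pts" using rho_equi by blast
        then obtain x where x: "x \<in> C" "p = \<phi> x" using \<open>p \<notin> ?P\<close> by blast
        then have "x \<notin> ?E" "f x \<notin> ?E" and fl: "f (flip x) = flip (f x)" using \<open>p \<notin> ?P\<close> by blast+
        then have e: "\<phi> x = fst x" "\<phi> (f x) = fst (f x)" using x(1) C[OF f] by blast+
        have fx: "fst (f (p, True)) = fst (f x)"
        proof (cases "snd x")
          case True
          then have "(p, True) = x" using x e by (simp add: prod_eq_iff)
          then show ?thesis by simp
        next
          case False
          then have "(p, True) = flip x" using x e by (simp add: prod_eq_iff flip_def)
          then show ?thesis using fl by simp
        qed
        have "\<rho> f p = fst (f x)" unfolding x(2) rho_phi[OF x(1)] by (rule e(2))
        then show False using neq fx by simp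
      qed
      moreover have "finite (f -` ?E)" using fin1 bij_is_inj[OF G_bij[OF f]] by (rule finite_vimageI)
      then have "finite ?P" using fin1 fin2 near[OF f] by (intro finite_UnI finite_imageI)
      ultimately show ?thesis by (rule finite_subset)
    qed
  qed (rule comp)
qed

end

section \<open>One-sided limits of monotone functions\<close>

lemma continuous_inj_on_monotone:
  fixes H :: "real \<Rightarrow> real"
  assumes cont: "continuous_on {a<..<b} H" and inj: "inj_on H {a<..<b}"
  shows "strict_mono_on {a<..<b} H \<or> strict_antimono_on {a<..<b} H"
proof (rule ccontr)
  assume "\<not> ?thesis"
  then obtain x y u v where xy: "x \<in> {a<..<b}" "y \<in> {a<..<b}" "x < y" "\<not> H x < H y"
    and uv: "u \<in> {a<..<b}" "v \<in> {a<..<b}" "u < v" "\<not> H v < H u"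
    unfolding monotone_on_def by blast
  \<comment> \<open>Moving the pair \<open>(x, y)\<close> linearly to \<open>(u, v)\<close>, the increment of \<open>H\<close> changes sign, so it vanishes somewhere.\<close>
  define l r where "l s = (1 - s) * x + s * u" and "r s = (1 - s) * y + s * v" for s
  have lr: "l s \<in> {a<..<b}" "r s \<in> {a<..<b}" "l s < r s" if "s \<in> {0..1}" for s
  proof -
    have "convex {a<..<b}" by (rule convex_real_interval)
    then show "l s \<in> {a<..<b}" "r s \<in> {a<..<b}"
      using xy uv that unfolding l_def r_def convex_alt by auto
    have "0 < (1 - s) * (y - x) + s * (v - u)"
    proof (cases "s = 0")
      case False
      then show ?thesis using xy(3) uv(3) that by (intro add_nonneg_pos mult_nonneg_nonneg mult_pos_pos) auto
    qed (use xy(3) in simp)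
    then show "l s < r s" by (simp add: l_def r_def algebra_simps)
  qed
  have "continuous_on {0..1} (\<lambda>s. H (r s) - H (l s))"
    using lr unfolding l_def r_def
    by (intro continuous_intros continuous_on_compose2[OF cont]) auto
  moreover have "H (r 0) - H (l 0) \<le> 0" "0 \<le> H (r 1) - H (l 1)"
    using xy uv by (simp_all add: l_def r_def)
  ultimately obtain s where s: "s \<in> {0..1}" "H (r s) - H (l s) = 0"
    using IVT'[of "\<lambda>s. H (r s) - H (l s)" 0 0 1] by auto
  then have "l s = r s" using inj_onD[OF inj, of "l s" "r s"] lr[OF s(1)] by simp
  then show False using lr(3)[OF s(1)] by simp
qed

text \<open>\<open>True\<close> is the right side. With Boolean sides a monotone map sends side
  \<open>c\<close> to side \<open>c \<longleftrightarrow> m\<close>, where \<open>m\<close> is true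
  for increasing maps.\<close>

definition at_side :: "bool \<Rightarrow> real \<Rightarrow> real filter"
  where "at_side c t = (if c then at_right t else at_left t)"

definition side_interval :: "bool \<Rightarrow> real \<Rightarrow> real \<Rightarrow> real set"
  where "side_interval c t e = (if c then {t<..<t + e} else {t - e<..<t})"

lemma eventually_at_side:
  "eventually P (at_side c t) \<longleftrightarrow> (\<exists>e>0. \<forall>s\<in>side_interval c t e. P s)"
proof (cases c)
  case True
  have "(\<exists>b>t. \<forall>y>t. y < b \<longrightarrow> P y) \<longleftrightarrow> (\<exists>e>0. \<forall>s\<in>{t<..<t + e}. P s)"
  proof
    assume "\<exists>b>t. \<forall>y>t. y < b \<longrightarrow> P y"
    then obtain b where "b > t" "\<forall>y>t. y < b \<longrightarrow> P y" by blast
    then show "\<exists>e>0. \<forall>s\<in>{t<..<t + e}. P s" by (intro exI[of _ "b - t"]) auto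
  next
    assume "\<exists>e>0. \<forall>s\<in>{t<..<t + e}. P s"
    then obtain e where "e > 0" "\<forall>s\<in>{t<..<t + e}. P s" by blast
    then show "\<exists>b>t. \<forall>y>t. y < b \<longrightarrow> P y" by (intro exI[of _ "t + e"]) auto
  qed
  then show ?thesis using True by (simp add: at_side_def side_interval_def eventually_at_right_field)
next
  case False
  have "(\<exists>b<t. \<forall>y>b. y < t \<longrightarrow> P y) \<longleftrightarrow> (\<exists>e>0. \<forall>s\<in>{t - e<..<t}. P s)"
  proof
    assume "\<exists>b<t. \<forall>y>b. y < t \<longrightarrow> P y"
    then obtain b where "b < t" "\<forall>y>b. y < t \<longrightarrow> P y" by blast
    then show "\<exists>e>0. \<forall>s\<in>{t - e<..<t}. P s" by (intro exI[of _ "t - b"]) auto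
  next
    assume "\<exists>e>0. \<forall>s\<in>{t - e<..<t}. P s"
    then obtain e where "e > 0" "\<forall>s\<in>{t - e<..<t}. P s" by blast
    then show "\<exists>b<t. \<forall>y>b. y < t \<longrightarrow> P y" by (intro exI[of _ "t - e"]) auto
  qed
  then show ?thesis using False by (simp add: at_side_def side_interval_def eventually_at_left_field)
qed

lemma eventually_at_sideI:
  "e > 0 \<Longrightarrow> (\<And>s. s \<in> side_interval c t e \<Longrightarrow> P s) \<Longrightarrow> eventually P (at_side c t)"
  unfolding eventually_at_side by blast

lemma at_side_neq_bot: "at_side c t \<noteq> bot"
  by (simp add: at_side_def)

lemma at_side_le_at: "at_side c t \<le> at t"
  by (simp add: at_side_def at_le)

lemma at_side_shift: "filtermap (\<lambda>x. x - d) (at_side c t) = at_side c (t - d)"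
  unfolding at_side_def
  by (auto simp: filter_eq_iff eventually_filtermap eventually_at_filter filtermap_nhds_shift[symmetric])

lemma at_side_minus: "filtermap uminus (at_side c t) = at_side (\<not> c) (- t)"
  using at_left_minus[of "- t"] at_right_minus[of "- t"] by (simp add: at_side_def)

text \<open>With \<open>L\<close> the infimum of the values, the intermediate value theorem shows
  that \<open>H\<close> maps the open interval from \<open>a\<close> to \<open>u\<close> onto the
  one from \<open>L\<close> to \<open>H u\<close>. As \<open>H u\<close> comes arbitrarily close to
  \<open>L\<close>, neighbourhood bases correspond.\<close>

lemma filtermap_at_right_strict_mono:
  fixes H :: "real \<Rightarrow> real"
  assumes ab: "a < b" and cont: "continuous_on {a<..<b} H"
    and mono: "strict_mono_on {a<..<b} H" and bdd: "bdd_below (H ` {a<..<b})"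
  obtains L where "filtermap H (at_right a) = at_right L"
proof -
  define L where "L = Inf (H ` {a<..<b})"
  have ne: "H ` {a<..<b} \<noteq> {}" using ab by simp
  have less: "H s < H u" if "a < s" "s < u" "u < b" for s u
    using mono that unfolding monotone_on_def by auto
  have L_less: "L < H s" if s: "a < s" "s < b" for s
  proof -
    obtain r where r: "a < r" "r < s" using dense[OF s(1)] by blast
    have "L \<le> H r" unfolding L_def using r s by (intro cInf_lower[OF _ bdd]) auto
    then show ?thesis using less[OF r s(2)] by simp
  qed
  have img: "H ` {a<..<u} = {L<..<H u}" if u: "a < u" "u < b" for u
  proof (intro equalityI subsetI)
    fix y assume "y \<in> H ` {a<..<u}"
    then show "y \<in> {L<..<H u}" using L_less less u by auto
  next
    fix y assume y: "y \<in> {L<..<H u}"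
    then obtain r where r: "a < r" "r < b" "H r < y"
      using cInf_less_iff[OF ne bdd, of y] by (auto simp: L_def)
    have ru: "r < u" using r y less[of u r] u by (metis greaterThanLessThan_iff less_asym less_linear order_less_trans)
    have "continuous_on {r..u} H" by (rule continuous_on_subset[OF cont]) (use r u in auto)
    then obtain s where s: "r \<le> s" "s \<le> u" "H s = y"
      using IVT'[of H r y u] r y ru by auto
    then have "s < u" using y by (cases "s = u") auto
    then show "y \<in> H ` {a<..<u}" using s r by auto
  qed
  have "filtermap H (at_right a) = at_right L"
  proof (rule filter_eqI)
    fix P
    have "eventually P (filtermap H (at_right a)) \<longleftrightarrow> (\<exists>u. a < u \<and> u < b \<and> (\<forall>y\<in>H ` {a<..<u}. P y))"
      (is "?l \<longleftrightarrow> ?m")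
    proof
      assume ?l
      then obtain c where c: "c > a" "\<forall>y>a. y < c \<longrightarrow> P (H y)"
        by (auto simp: eventually_filtermap eventually_at_right_field)
      obtain u where "a < u" "u < min b c" using dense[of a "min b c"] ab c(1) by auto
      then show ?m using c(2) by (intro exI[of _ u]) auto
    next
      assume ?m
      then show ?l by (auto simp: eventually_filtermap eventually_at_right_field)
    qed
    also have "\<dots> \<longleftrightarrow> (\<exists>u. a < u \<and> u < b \<and> (\<forall>y\<in>{L<..<H u}. P y))"
      using img by (metis (no_types, lifting))
    also have "\<dots> \<longleftrightarrow> eventually P (at_right L)" (is "?m' \<longleftrightarrow> ?r")
    proof
      assume ?m'
      then obtain u where u: "a < u" "u < b" "\<forall>y\<in>{L<..<H u}. P y" by blast
      then show ?r unfolding eventually_at_right_field using L_less[OF u(1,2)] by (intro exI[of _ "H u"]) auto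
    next
      assume ?r
      then obtain c where c: "c > L" "\<forall>y>L. y < c \<longrightarrow> P y" by (auto simp: eventually_at_right_field)
      then obtain r where "a < r" "r < b" "H r < c"
        using cInf_less_iff[OF ne bdd, of c] by (auto simp: L_def)
      then show ?m' using c(2) by (intro exI[of _ r]) auto
    qed
    finally show "eventually P (filtermap H (at_right a)) \<longleftrightarrow> eventually P (at_right L)" .
  qed
  then show thesis by (rule that)
qed

lemma filtermap_at_side_monotone:
  fixes H :: "real \<Rightarrow> real"
  assumes e: "e > 0" and cont: "continuous_on (side_interval c t e) H"
    and mono: "if m then strict_mono_on (side_interval c t e) H else strict_antimono_on (side_interval c t e) H"
    and bdd: "\<And>s. s \<in> side_interval c t e \<Longrightarrow> \<bar>H s\<bar> \<le> B"
  obtains L where "filtermap H (at_side c t) = at_side (c \<longleftrightarrow> m) L"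
proof -
  define \<sigma> where "\<sigma> c = (if c then 1 else -1 :: real)" for c
  have sig: "\<sigma> c * \<sigma> c = 1" for c by (simp add: \<sigma>_def)
  have side: "filtermap (\<lambda>x. \<sigma> d * x) (at_side c t) = at_side (c \<longleftrightarrow> d) (\<sigma> d * t)" for c d t
    using at_side_minus[of c t] by (cases d) (auto simp: \<sigma>_def filtermap_ident)
  define t' where "t' = \<sigma> c * t"
  \<comment> \<open>The domain is reflected when \<open>c\<close> is the left side, the target when
    exactly one of \<open>c\<close> and \<open>m\<close> is false. In all four cases
    \<open>K\<close> increases to the right of \<open>t'\<close>.\<close>
  define K where "K s = \<sigma> (c \<longleftrightarrow> m) * H (\<sigma> c * s)" for s
  have mem: "\<sigma> c * s \<in> side_interval c t e" if "s \<in> {t'<..<t' + e}" for s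
    using that by (cases c) (auto simp: \<sigma>_def side_interval_def t'_def)
  have "continuous_on {t'<..<t' + e} K"
    unfolding K_def by (intro continuous_intros continuous_on_compose2[OF cont]) (use mem in auto)
  moreover have "strict_mono_on {t'<..<t' + e} K"
  proof (rule strict_mono_onI)
    fix r s assume rs: "r \<in> {t'<..<t' + e}" "s \<in> {t'<..<t' + e}" "r < s"
    show "K r < K s"
      using mono mem[OF rs(1)] mem[OF rs(2)] rs(3) unfolding K_def
      by (cases c; cases m) (auto simp: \<sigma>_def monotone_on_def)
  qed
  moreover have "bdd_below (K ` {t'<..<t' + e})"
  proof (rule bdd_belowI[of _ "- B"])
    fix x assume "x \<in> K ` {t'<..<t' + e}"
    then obtain s where "s \<in> {t'<..<t' + e}" "x = K s" by blast
    then show "- B \<le> x" using bdd[OF mem, of s] by (auto simp: K_def \<sigma>_def)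
  qed
  ultimately obtain L where L: "filtermap K (at_right t') = at_right L"
    using e by (elim filtermap_at_right_strict_mono[of t' "t' + e" K, rotated 1]) auto
  have "H = (\<lambda>s. \<sigma> (c \<longleftrightarrow> m) * K (\<sigma> c * s))"
    unfolding K_def using sig by (simp add: mult.assoc[symmetric])
  then have "filtermap H (at_side c t) =
      filtermap (\<lambda>x. \<sigma> (c \<longleftrightarrow> m) * x) (filtermap K (filtermap (\<lambda>x. \<sigma> c * x) (at_side c t)))"
    by (simp add: filtermap_filtermap)
  also have "filtermap (\<lambda>x. \<sigma> c * x) (at_side c t) = at_right t'"
    unfolding side by (simp add: at_side_def t'_def)
  also have "filtermap K \<dots> = at_side True L" using L by (simp add: at_side_def)
  also have "filtermap (\<lambda>x. \<sigma> (c \<longleftrightarrow> m) * x) \<dots> = at_side (c \<longleftrightarrow> m) (\<sigma> (c \<longleftrightarrow> m) * L)"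
    unfolding side by simp
  finally show thesis by (rule that)
qed

section \<open>The action on one-sided germs\<close>

text \<open>As filters, one-sided germs are moved by \<open>filtermap\<close>, which respects
  composition. The chosen representative is immaterial by \<open>germ_abs\<close>.\<close>

definition germ :: "circle \<times> bool \<Rightarrow> circle filter"
  where "germ d = filtermap abs_circle (at_side (snd d) (rep_circle (fst d)))"

lemma abs_circle_diff_Ints: "k \<in> \<int> \<Longrightarrow> abs_circle (x - k) = abs_circle x"
  by (simp add: abs_circle_eq_iff)

lemma germ_abs: "germ (abs_circle t, c) = filtermap abs_circle (at_side c t)"
proof -
  define k where "k = t - rep_circle (abs_circle t)"
  have "k \<in> \<int>"
    unfolding k_def by (metis abs_circle_eq_iff Quotient_circle Quotient_abs_rep)
  moreover have "rep_circle (abs_circle t) = t - k" by (simp add: k_def)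
  ultimately have "germ (abs_circle t, c) = filtermap abs_circle (filtermap (\<lambda>x. x - k) (at_side c t))"
    by (simp add: germ_def at_side_shift)
  then show ?thesis using \<open>k \<in> \<int>\<close> by (simp add: filtermap_filtermap abs_circle_diff_Ints)
qed

lemma circle_side_cases:
  obtains t c where "d = (abs_circle t, c)"
  by (metis abs_circle_surj surj_pair)

lemma germ_neq_bot: "germ d \<noteq> bot"
  by (simp add: germ_def filtermap_bot_iff at_side_neq_bot)

lemma germ_le_nhds: "germ (p, c) \<le> nhds p"
proof -
  obtain t where t: "p = abs_circle t" by (rule abs_circle_surj)
  have "filterlim abs_circle (nhds p) (at t)"
    using continuous_abs_circle[of t] unfolding isCont_def t .
  then have "filterlim abs_circle (nhds p) (at_side c t)"
    by (rule filterlim_mono[OF _ order_refl at_side_le_at])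
  then show ?thesis unfolding t germ_abs filterlim_def .
qed

lemma germ_le_nhds_fst: "germ d \<le> nhds (fst d)"
  using germ_le_nhds[of "fst d" "snd d"] by simp

lemma eventually_at_side_interval: "e > 0 \<Longrightarrow> \<forall>\<^sub>F s in at_side c t. s \<in> side_interval c t e"
  by (rule eventually_at_sideI)

lemma side_interval_abs: "s \<in> side_interval c t e \<Longrightarrow> s \<noteq> t \<and> \<bar>s - t\<bar> < e"
  by (auto simp: side_interval_def split: if_splits)

lemma abs_circle_near_neq: "s \<noteq> t \<Longrightarrow> \<bar>s - t\<bar> < 1 \<Longrightarrow> abs_circle s \<noteq> abs_circle t"
  unfolding abs_circle_eq_iff using Ints_nonzero_abs_less1[of "s - t"] by auto

lemma germ_le_at: "germ (p, c) \<le> at p"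
proof -
  obtain t where t: "p = abs_circle t" by (rule abs_circle_surj)
  have "\<forall>\<^sub>F s in at_side c t. abs_circle s \<noteq> abs_circle t"
    by (rule eventually_at_sideI[of 1]) (auto dest: side_interval_abs abs_circle_near_neq[rotated])
  then have "germ (p, c) \<le> principal (- {p})"
    by (simp add: t germ_abs le_principal eventually_filtermap)
  then show ?thesis using germ_le_nhds by (simp add: at_within_def Compl_eq_Diff_UNIV)
qed

lemma eventually_germ_neq: "\<forall>\<^sub>F x in germ d. x \<noteq> q"
proof (cases "fst d = q")
  case True
  have "germ d \<le> at (fst d)" using germ_le_at[of "fst d" "snd d"] by simp
  then have "germ d \<le> at q" using True by simp
  then show ?thesis by (rule filter_leD) (simp add: eventually_at_filter)
next
  case False
  then have "\<forall>\<^sub>F x in nhds (fst d). x \<noteq> q" by (rule t1_space_nhds)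
  then show ?thesis using germ_le_nhds[of "fst d" "snd d"] by (simp add: filter_leD)
qed

lemma germ_le_nhds_unique: "germ d \<le> nhds p \<Longrightarrow> fst d = p"
  using tendsto_unique[OF germ_neq_bot, of "\<lambda>x. x" "fst d" d p] germ_le_nhds[of "fst d" "snd d"]
  by (simp add: filterlim_def)

text \<open>Hausdorff separation recovers the point; the side is recovered because the left and
  right intervals of length 1/2 have disjoint images in the circle.\<close>

lemma germ_inject: "germ d = germ e \<longleftrightarrow> d = e"
proof
  assume eq: "germ d = germ e"
  then have f: "fst d = fst e"
    using germ_le_nhds_unique[of d "fst e"] germ_le_nhds[of "fst e" "snd e"] by simp
  obtain t where t: "fst d = abs_circle t" by (rule abs_circle_surj)
  have "snd d = snd e"
  proof (rule ccontr)
    assume "snd d \<noteq> snd e"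
    then have LR: "germ (abs_circle t, True) = germ (abs_circle t, False)"
      using eq f t by (metis (full_types) prod.collapse)
    have "\<forall>\<^sub>F x in germ (abs_circle t, True). x \<in> abs_circle ` side_interval True t (1/2)"
      unfolding germ_abs eventually_filtermap
      by (rule eventually_mono[OF eventually_at_side_interval[of "1/2"]]) auto
    moreover have "\<forall>\<^sub>F x in germ (abs_circle t, False). x \<notin> abs_circle ` side_interval True t (1/2)"
      unfolding germ_abs eventually_filtermap
    proof (rule eventually_mono[OF eventually_at_side_interval[of "1/2"]])
      fix s assume s: "s \<in> side_interval False t (1/2)"
      show "abs_circle s \<notin> abs_circle ` side_interval True t (1/2)"
      proof
        assume "abs_circle s \<in> abs_circle ` side_interval True t (1/2)"
        then obtain u where "abs_circle s = abs_circle u" "u \<in> side_interval True t (1/2)" by blast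
        then show False using s abs_circle_near_neq[of s u] by (auto simp: side_interval_def)
      qed
    qed simp
    ultimately have "\<forall>\<^sub>F x in germ (abs_circle t, False). False"
      unfolding LR by eventually_elim simp
    then show False using germ_neq_bot by simp
  qed
  then show "d = e" using f by (simp add: prod_eq_iff)
qed simp

section \<open>Local lifts of piecewise continuous permutations\<close>

lemma circle_sec_inject: "circle_sec a p = circle_sec a q \<longleftrightarrow> p = q"
  by (metis abs_circle_sec)

lemma circle_sec_bounds: "a - 1/2 \<le> circle_sec a p" "circle_sec a p < a + 1/2"
  using frac_lt_1[of "rep_circle p - a + 1/2"] by (auto simp: circle_sec_def)

text \<open>The section \<open>circle_sec a\<close> is continuous off
  \<open>abs_circle (a - 1/2)\<close>, a value that \<open>window\<close> excludes. So the lift is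
  continuous and, over less than a full turn, injective, hence monotone. The interval omits
  \<open>t\<close>, where \<open>f\<close> may jump.\<close>

lemma local_lift_monotone:
  fixes f :: "circle \<Rightarrow> circle"
  assumes inj: "inj f" and F: "finite F" "\<And>x. x \<notin> F \<Longrightarrow> isCont f x"
    and window: "\<forall>\<^sub>F s in at_side c t. f (abs_circle s) \<noteq> abs_circle (a - 1/2)"
  defines "H \<equiv> \<lambda>s. circle_sec a (f (abs_circle s))"
  obtains e m where "e > 0" "e < 1/2" "continuous_on (side_interval c t e) H"
    "if m then strict_mono_on (side_interval c t e) H else strict_antimono_on (side_interval c t e) H"
proof -
  have "\<forall>\<^sub>F s in at_side c t. \<forall>q\<in>F. abs_circle s \<noteq> q"
    using eventually_germ_neq[of _ "(abs_circle t, c)"] F(1)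
    by (intro eventually_ball_finite) (simp_all add: germ_abs eventually_filtermap)
  then have "\<forall>\<^sub>F s in at_side c t. f (abs_circle s) \<noteq> abs_circle (a - 1/2) \<and> abs_circle s \<notin> F"
    using window by eventually_elim blast
  then obtain e0 where e0: "e0 > 0" "\<And>s. s \<in> side_interval c t e0 \<Longrightarrow> f (abs_circle s) \<noteq> abs_circle (a - 1/2) \<and> abs_circle s \<notin> F"
    unfolding eventually_at_side by blast
  define e where "e = min e0 (1/3)"
  have e: "e > 0" "e < 1/2" using e0(1) by (auto simp: e_def)
  have sub: "side_interval c t e \<subseteq> side_interval c t e0" by (auto simp: side_interval_def e_def)
  have "isCont H s" if "s \<in> side_interval c t e" for s
  proof -
    have s: "f (abs_circle s) \<noteq> abs_circle (a - 1/2)" "abs_circle s \<notin> F" using e0(2) sub that by blast+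
    define u where "u = circle_sec a (f (abs_circle s))"
    have u: "abs_circle u = f (abs_circle s)" by (simp add: u_def)
    have "u \<noteq> a - 1/2" using s(1) u by auto
    then have "\<bar>u - a\<bar> < 1/2" using circle_sec_bounds[of a "f (abs_circle s)"] unfolding u_def by linarith
    then have "isCont (circle_sec a) (f (abs_circle s))" unfolding u[symmetric] by (rule isCont_circle_sec)
    moreover have "isCont (\<lambda>s. f (abs_circle s)) s" using F(2)[OF s(2)] by (simp add: isCont_circle_iff)
    ultimately show ?thesis unfolding H_def by (rule isCont_o2[rotated])
  qed
  then have cont: "continuous_on (side_interval c t e) H"
    by (simp add: continuous_at_imp_continuous_on)
  have "inj_on H (side_interval c t e)"
  proof (rule inj_onI)
    fix r s assume rs: "r \<in> side_interval c t e" "s \<in> side_interval c t e" "H r = H s"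
    then have "abs_circle r = abs_circle s" using inj by (simp add: H_def circle_sec_inject inj_eq)
    moreover have "\<bar>r - s\<bar> < 1" using rs(1,2) e(2) by (auto dest!: side_interval_abs)
    ultimately show "r = s" using abs_circle_near_neq by blast
  qed
  then have "strict_mono_on (side_interval c t e) H \<or> strict_antimono_on (side_interval c t e) H"
    using cont continuous_inj_on_monotone unfolding side_interval_def by (cases c) auto
  then show thesis using that[of e True] that[of e False] e cont by auto
qed

lemma filtermap_germ_lift:
  assumes "filtermap (\<lambda>s. circle_sec a (f (abs_circle s))) (at_side c t) = at_side c' L"
  shows "filtermap f (germ (abs_circle t, c)) = germ (abs_circle L, c')"
proof -
  have "filtermap f (germ (abs_circle t, c)) =
      filtermap abs_circle (filtermap (\<lambda>s. circle_sec a (f (abs_circle s))) (at_side c t))"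
    by (simp add: germ_abs filtermap_filtermap)
  then show ?thesis unfolding assms germ_abs .
qed

lemma circle_sec_abs_bound: "\<bar>circle_sec a p\<bar> \<le> \<bar>a\<bar> + 1"
  using circle_sec_bounds[of a p] by linarith

lemma filtermap_germ:
  assumes "f \<in> carrier PC_hat"
  obtains e where "filtermap f (germ d) = germ e"
proof -
  obtain F where bij: "bij f" and F: "finite F" "\<And>x. x \<notin> F \<Longrightarrow> isCont f x"
    using assms unfolding carrier_PC_hat by blast
  obtain t c where d: "d = (abs_circle t, c)" by (rule circle_side_cases)
  \<comment> \<open>The jump of the section is placed at the value of \<open>f\<close> at the base
    point, which injectivity keeps \<open>f\<close> from taking nearby.\<close>
  define a where "a = rep_circle (f (abs_circle t)) + 1/2"
  have a: "abs_circle (a - 1/2) = f (abs_circle t)"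
    unfolding a_def by simp (metis Quotient_circle Quotient_abs_rep)
  have "\<forall>\<^sub>F s in at_side c t. abs_circle s \<noteq> abs_circle t"
    using eventually_germ_neq[of "abs_circle t" "(abs_circle t, c)"] by (simp add: germ_abs eventually_filtermap)
  then have "\<forall>\<^sub>F s in at_side c t. f (abs_circle s) \<noteq> abs_circle (a - 1/2)"
    unfolding a by eventually_elim (use bij_is_inj[OF bij] in \<open>simp add: inj_eq\<close>)
  then obtain e m where e: "e > 0" "e < 1/2"
     "continuous_on (side_interval c t e) (\<lambda>s. circle_sec a (f (abs_circle s)))"
     "if m then strict_mono_on (side_interval c t e) (\<lambda>s. circle_sec a (f (abs_circle s)))
      else strict_antimono_on (side_interval c t e) (\<lambda>s. circle_sec a (f (abs_circle s)))"
    using local_lift_monotone[OF bij_is_inj[OF bij] F] by blast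
  obtain L where "filtermap (\<lambda>s. circle_sec a (f (abs_circle s))) (at_side c t) = at_side (c \<longleftrightarrow> m) L"
    using filtermap_at_side_monotone[OF e(1,3,4) circle_sec_abs_bound] by blast
  then show thesis using filtermap_germ_lift that unfolding d by blast
qed

section \<open>Permutations of the germs induced by \<open>PC_hat\<close>\<close>

definition germ_act :: "(circle \<Rightarrow> circle) \<Rightarrow> circle \<times> bool \<Rightarrow> circle \<times> bool"
  where "germ_act f d = (THE e. germ e = filtermap f (germ d))"

lemma germ_germ_act: "f \<in> carrier PC_hat \<Longrightarrow> germ (germ_act f d) = filtermap f (germ d)"
  unfolding germ_act_def by (rule theI', rule filtermap_germ[of f d]) (metis germ_inject)+

lemma germ_act_eqI: "f \<in> carrier PC_hat \<Longrightarrow> filtermap f (germ d) = germ e \<Longrightarrow> germ_act f d = e"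
  using germ_germ_act germ_inject by metis

lemma germ_act_comp:
  assumes "f \<in> carrier PC_hat" "g \<in> carrier PC_hat"
  shows "germ_act (f \<circ> g) = germ_act f \<circ> germ_act g"
proof
  fix d
  have "f \<circ> g \<in> carrier PC_hat"
    using monoid.m_closed[OF group.is_monoid[OF group_PC_hat] assms] by (simp add: mult_PC_hat assms)
  then show "germ_act (f \<circ> g) d = (germ_act f \<circ> germ_act g) d"
    by (rule germ_act_eqI) (simp add: germ_germ_act assms filtermap_filtermap comp_def)
qed

text \<open>A germ eventually avoids any finite set, so it does not see \<open>s\<close>. Thus the
  action descends to \<open>PC\<close>.\<close>

lemma germ_act_Sym_fin:
  assumes "s \<in> Sym_fin" shows "germ_act s = id"
proof
  fix d
  have "finite {x. s x \<noteq> x}" using assms by (simp add: Sym_fin_def)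
  then have "\<forall>\<^sub>F x in germ d. \<forall>q\<in>{x. s x \<noteq> x}. x \<noteq> q"
    using eventually_germ_neq by (intro eventually_ball_finite) auto
  then have ev: "\<forall>\<^sub>F x in germ d. s x = x" by eventually_elim blast
  have "filtermap s (germ d) = germ d"
  proof (rule filter_eqI)
    fix P
    have "eventually (\<lambda>x. P (s x)) (germ d) \<longleftrightarrow> eventually P (germ d)"
      using ev by (intro eventually_subst) (auto elim: eventually_mono)
    then show "eventually P (filtermap s (germ d)) \<longleftrightarrow> eventually P (germ d)"
      by (simp add: eventually_filtermap)
  qed
  then show "germ_act s d = id d"
    unfolding id_apply using assms Sym_fin_subset by (intro germ_act_eqI) auto
qed

lemma fst_germ_act:
  assumes "f \<in> carrier PC_hat" "isCont f p"
  shows "fst (germ_act f (p, c)) = f p"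
proof (rule germ_le_nhds_unique)
  have "filtermap f (germ (p, c)) \<le> filtermap f (nhds p)" by (rule filtermap_mono[OF germ_le_nhds])
  also have "(f \<longlongrightarrow> f p) (nhds p)"
    using assms(2) by (simp add: isCont_def tendsto_at_iff_tendsto_nhds)
  then have "filtermap f (nhds p) \<le> nhds (f p)" unfolding filterlim_def .
  finally show "germ (germ_act f (p, c)) \<le> nhds (f p)" by (simp add: germ_germ_act assms(1))
qed

lemma inj_germ_act:
  assumes "f \<in> carrier PC_hat" shows "inj (germ_act f)"
proof (rule injI)
  fix d e assume "germ_act f d = germ_act f e"
  then have "filtermap f (germ d) = filtermap f (germ e)" using germ_germ_act[OF assms] by metis
  moreover have "inj f" using assms by (simp add: carrier_PC_hat bij_is_inj)
  ultimately have "germ d = germ e" using filtermap_eq_strong by blast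
  then show "d = e" by (simp add: germ_inject)
qed

text \<open>At a point of continuity both germs go to germs at the image point; these are distinct
  by injectivity, and only two exist there.\<close>

lemma germ_act_flip:
  assumes "f \<in> carrier PC_hat" "isCont f (fst d)"
  shows "germ_act f (flip d) = flip (germ_act f d)"
proof -
  have "fst (germ_act f (flip d)) = fst (germ_act f d)"
    using fst_germ_act[OF assms, of "snd d"] fst_germ_act[OF assms, of "\<not> snd d"] by (simp add: flip_def)
  moreover have "germ_act f (flip d) \<noteq> germ_act f d"
    using inj_germ_act[OF assms(1)] by (simp add: inj_eq)
  ultimately show ?thesis by (auto simp: flip_def prod_eq_iff)
qed

text \<open>If the germ at \<open>t\<close> moves to another point, there are no fixed points nearby
  on that side. Otherwise the local lift is monotone: an increasing one sends right germs to right
  germs, a decreasing one has at most one fixed point.\<close>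

lemma eventually_not_reversed:
  assumes f: "f \<in> carrier PC_hat"
  shows "\<forall>\<^sub>F s in at_side c t. \<not> (f (abs_circle s) = abs_circle s \<and> germ_act f (abs_circle s, True) = (abs_circle s, False))"
proof (cases "fst (germ_act f (abs_circle t, c)) = abs_circle t")
  case False
  then obtain U V where UV: "open U" "open V" "fst (germ_act f (abs_circle t, c)) \<in> U" "abs_circle t \<in> V" "U \<inter> V = {}"
    using hausdorff[OF False] by blast
  have "\<forall>\<^sub>F x in germ (germ_act f (abs_circle t, c)). x \<in> U"
    using UV germ_le_nhds[of "fst (germ_act f (abs_circle t, c))" "snd (germ_act f (abs_circle t, c))"]
    by (simp add: filter_leD[OF _ eventually_nhds_in_open])
  then have "\<forall>\<^sub>F s in at_side c t. f (abs_circle s) \<in> U"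
    by (simp add: germ_germ_act f germ_abs eventually_filtermap)
  moreover have "\<forall>\<^sub>F s in at_side c t. abs_circle s \<in> V"
    using filter_leD[OF germ_le_nhds eventually_nhds_in_open[OF UV(2,4)], of c] by (simp add: germ_abs eventually_filtermap)
  ultimately show ?thesis by eventually_elim (use UV(5) in auto)
next
  case True
  obtain F where bij: "bij f" and F: "finite F" "\<And>x. x \<notin> F \<Longrightarrow> isCont f x"
    using f unfolding carrier_PC_hat by blast
  \<comment> \<open>The section is now centred at \<open>t\<close>, so that nearby fixed points of
    \<open>f\<close> become fixed points of \<open>H\<close>. Its jump is avoided since the germ is
    sent to a germ at the same point.\<close>
  define H where "H s = circle_sec t (f (abs_circle s))" for s
  have "\<forall>\<^sub>F x in nhds (abs_circle t). x \<noteq> abs_circle (t - 1/2)"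
    using abs_circle_near_neq[of t "t - 1/2"] by (intro t1_space_nhds) auto
  moreover have "germ (germ_act f (abs_circle t, c)) \<le> nhds (abs_circle t)"
    using germ_le_nhds_fst[of "germ_act f (abs_circle t, c)"] True by simp
  ultimately have "\<forall>\<^sub>F x in germ (germ_act f (abs_circle t, c)). x \<noteq> abs_circle (t - 1/2)"
    by (rule filter_leD[rotated])
  then have "\<forall>\<^sub>F s in at_side c t. f (abs_circle s) \<noteq> abs_circle (t - 1/2)"
    by (simp add: germ_germ_act f germ_abs eventually_filtermap)
  then obtain e m where e: "e > 0" "e < 1/2" "continuous_on (side_interval c t e) H"
     "if m then strict_mono_on (side_interval c t e) H else strict_antimono_on (side_interval c t e) H"
    using local_lift_monotone[OF bij_is_inj[OF bij] F] unfolding H_def[abs_def] by blast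
  have fixed: "H s = s" if "s \<in> side_interval c t e" "f (abs_circle s) = abs_circle s" for s
    using that e(2) circle_sec_near[of s t] by (auto simp: H_def dest!: side_interval_abs)
  show ?thesis
  proof (cases m)
    case True
    show ?thesis
    proof (rule eventually_at_sideI[OF e(1)])
      fix s assume s: "s \<in> side_interval c t e"
      \<comment> \<open>This is the distance from \<open>s\<close> to the right end of the interval,
        so monotonicity holds just to the right of \<open>s\<close>.\<close>
      define e' where "e' = (if c then t + e - s else t - s)"
      have e': "e' > 0" "side_interval True s e' \<subseteq> side_interval c t e"
        using s by (auto simp: side_interval_def e'_def split: if_splits)
      have "if True then strict_mono_on (side_interval True s e') H else strict_antimono_on (side_interval True s e') H"
        using e(4) True e'(2) monotone_on_subset by auto
      then obtain L where "filtermap H (at_side True s) = at_side (True \<longleftrightarrow> True) L"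
        using filtermap_at_side_monotone[OF e'(1) continuous_on_subset[OF e(3) e'(2)], of True "\<bar>t\<bar> + 1"]
          circle_sec_abs_bound unfolding H_def by blast
      then have "filtermap f (germ (abs_circle s, True)) = germ (abs_circle L, True)"
        using filtermap_germ_lift[of t f True s True L] by (simp add: H_def[abs_def])
      then have "germ_act f (abs_circle s, True) = (abs_circle L, True)" by (rule germ_act_eqI[OF f])
      then show "\<not> (f (abs_circle s) = abs_circle s \<and> germ_act f (abs_circle s, True) = (abs_circle s, False))" by simp
    qed
  next
    case False
    then have anti: "H s < H r" if "r \<in> side_interval c t e" "s \<in> side_interval c t e" "r < s" for r s
      using e(4) that by (auto simp: monotone_on_def)
    have uniq: "r = s" if "r \<in> side_interval c t e" "s \<in> side_interval c t e"
      "f (abs_circle r) = abs_circle r" "f (abs_circle s) = abs_circle s" for r s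
      using anti[OF that(1,2)] anti[OF that(2,1)] fixed[OF that(1,3)] fixed[OF that(2,4)] by linarith
    show ?thesis
    proof (cases "\<exists>r\<in>side_interval c t e. f (abs_circle r) = abs_circle r")
      case True
      then obtain r where r: "r \<in> side_interval c t e" "f (abs_circle r) = abs_circle r" by blast
      \<comment> \<open>Shrinking the interval to length \<open>\<bar>r - t\<bar>\<close> drops the
        only fixed point \<open>r\<close>.\<close>
      have "\<forall>\<^sub>F s in at_side c t. s \<in> side_interval c t \<bar>r - t\<bar>"
        using r(1) by (intro eventually_at_side_interval) (auto dest: side_interval_abs)
      then show ?thesis
      proof eventually_elim
        case (elim s)
        then have "s \<noteq> r" "s \<in> side_interval c t e"
          using r(1) by (auto simp: side_interval_def split: if_splits)
        then show ?case using uniq[of s r] r by blast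
      qed
    next
      case False
      then show ?thesis by (intro eventually_at_sideI[OF e(1)]) blast
    qed
  qed
qed

text \<open>Infinitely many reversed points would accumulate somewhere in the compact unit interval,
  which \<open>eventually_not_reversed\<close> forbids on either side. The finitely many points of
  \<open>F\<close> are treated apart.\<close>

lemma finite_reversed:
  assumes f: "f \<in> carrier PC_hat"
  shows "finite {d. germ_act f d = flip d}"
proof -
  obtain F where bij: "bij f" and F: "finite F" "\<And>x. x \<notin> F \<Longrightarrow> isCont f x"
    using f unfolding carrier_PC_hat by blast
  let ?P = "\<lambda>p. f p = p \<and> germ_act f (p, True) = (p, False)"
  let ?Z = "{s \<in> {0..1}. ?P (abs_circle s)}"
  have finZ: "finite ?Z"
  proof (rule ccontr)
    assume inf: "infinite ?Z"
    have "compact {0..1::real}" by (rule compact_Icc)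
    then obtain t where "t islimpt ?Z"
      using inf unfolding compact_eq_Bolzano_Weierstrass by (metis (no_types, lifting) mem_Collect_eq subsetI)
    moreover have "\<forall>\<^sub>F s in at t. \<not> ?P (abs_circle s)"
      using eventually_not_reversed[OF f, of True t] eventually_not_reversed[OF f, of False t]
      unfolding at_eq_sup_left_right at_side_def by (simp add: eventually_sup)
    then have "\<forall>\<^sub>F s in at t. s \<notin> ?Z" by (rule eventually_mono) simp
    ultimately show False by (simp add: islimpt_iff_eventually)
  qed
  have "{d. germ_act f d = flip d} \<subseteq> (abs_circle ` ?Z \<union> F) \<times> UNIV"
  proof
    fix d assume "d \<in> {d. germ_act f d = flip d}"
    then have d: "germ_act f d = flip d" by simp
    obtain p b where pb: "d = (p, b)" by (cases d)
    show "d \<in> (abs_circle ` ?Z \<union> F) \<times> UNIV"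
    proof (cases "p \<in> F")
      case False
      then have c: "isCont f (fst d)" "isCont f p" using F(2) pb by simp_all
      have "f p = p" using fst_germ_act[OF f c(2), of b] d pb by simp
      moreover have "germ_act f (p, True) = (p, False)"
        using d germ_act_flip[OF f c(1)] by (cases b) (auto simp: flip_def pb)
      moreover define s where "s = frac (rep_circle p)"
      have "rep_circle p - s \<in> \<int>" by (simp add: s_def frac_def)
      then have "abs_circle s = p" by (metis abs_circle_eq_iff Quotient_circle Quotient_abs_rep)
      moreover have "s \<in> {0..1}" unfolding s_def using frac_lt_1[of "rep_circle p"] by simp
      ultimately have "p \<in> abs_circle ` ?Z" by (intro image_eqI[of _ _ s]) auto
      then show ?thesis by (simp add: pb)
    qed (simp add: pb)
  qed
  then show ?thesis 
    by (rule finite_subset) (intro finite_cartesian_product finite_UnI finite_imageI finZ F(1) finite)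
qed

lemma finite_germ_act_not_flip:
  assumes "f \<in> carrier PC_hat"
  shows "finite {d. germ_act f (flip d) \<noteq> flip (germ_act f d)}"
proof -
  obtain F where F: "finite F" "\<And>x. x \<notin> F \<Longrightarrow> isCont f x"
    using assms unfolding carrier_PC_hat by blast
  have "{d. germ_act f (flip d) \<noteq> flip (germ_act f d)} \<subseteq> F \<times> UNIV"
    using germ_act_flip[OF assms] F(2) by fastforce
  then show ?thesis by (rule finite_subset) (simp add: F(1))
qed

section \<open>Realization\<close>

lemma germ_act_bij:
  assumes f: "f \<in> carrier PC_hat" shows "bij (germ_act f)"
proof -
  have g: "inv_into UNIV f \<in> carrier PC_hat"
    using group.inv_closed[OF group_PC_hat f] by (simp add: inv_PC_hat f)
  have "bij f" using f by (simp add: carrier_PC_hat)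
  then have "f \<circ> inv_into UNIV f = id" "inv_into UNIV f \<circ> f = id"
    by (simp_all add: bij_is_inj bij_is_surj surj_iff[symmetric])
  moreover have "germ_act id = id" by (rule germ_act_Sym_fin) (simp add: Sym_fin_def Bij_def)
  ultimately show ?thesis
    using germ_act_comp[OF f g] germ_act_comp[OF g f] by (intro o_bij[of "germ_act (inv_into UNIV f)"]) simp_all
qed

lemma subgroup_Sym_fin: "subgroup Sym_fin PC_hat"
  using normal_Sym_fin by (rule normal_imp_subgroup)

lemma germ_act_cong:
  assumes f: "f \<in> carrier PC_hat" and g: "g \<in> carrier PC_hat" and eq: "PC_proj f = PC_proj g"
  shows "germ_act f = germ_act g"
proof -
  have "g \<in> Sym_fin #>\<^bsub>PC_hat\<^esub> f"
    using group.rcos_self[OF group_PC_hat g subgroup_Sym_fin] eq by (simp add: PC_proj_def)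
  then obtain s where s: "s \<in> Sym_fin" "g = s \<otimes>\<^bsub>PC_hat\<^esub> f" by (auto simp: r_coset_def)
  then have "g = s \<circ> f" using f Sym_fin_subset by (simp add: mult_PC_hat subset_iff)
  then show ?thesis
    using germ_act_comp[of s f] germ_act_Sym_fin[OF s(1)] s(1) f Sym_fin_subset by auto
qed

lemma PC_proj_eqI:
  assumes f: "f \<in> carrier PC_hat" and r: "bij r" and fin: "finite {x. r x \<noteq> f x}"
  shows "r \<in> carrier PC_hat" "PC_proj r = PC_proj f"
proof -
  have bf: "bij f" using f by (simp add: carrier_PC_hat)
  define s where "s = r \<circ> inv_into UNIV f"
  have "{y. s y \<noteq> y} \<subseteq> f ` {x. r x \<noteq> f x}"
  proof
    fix y assume "y \<in> {y. s y \<noteq> y}"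
    moreover have "f (inv_into UNIV f y) = y" using bf by (simp add: bij_is_surj surj_f_inv_f)
    ultimately show "y \<in> f ` {x. r x \<noteq> f x}"
      by (intro image_eqI[of _ _ "inv_into UNIV f y"]) (auto simp: s_def)
  qed
  then have "finite {y. s y \<noteq> y}" using fin by (metis finite_imageI finite_subset)
  moreover have "bij s" unfolding s_def by (intro bij_comp bij_imp_bij_inv bf r)
  ultimately have s: "s \<in> Sym_fin" by (simp add: Sym_fin_def Bij_def)
  have "r = s \<circ> f" using bf by (auto simp: s_def bij_is_inj)
  then have rs: "r = s \<otimes>\<^bsub>PC_hat\<^esub> f" using s f Sym_fin_subset by (simp add: mult_PC_hat subset_iff)
  then show "r \<in> carrier PC_hat"
    using monoid.m_closed[OF group.is_monoid[OF group_PC_hat], of s f] s f Sym_fin_subset by auto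
  have "r \<in> Sym_fin #>\<^bsub>PC_hat\<^esub> f" using s rs by (auto simp: r_coset_def)
  then show "PC_proj r = PC_proj f"
    unfolding PC_proj_def using group.repr_independence[OF group_PC_hat _ f subgroup_Sym_fin] by metis
qed

text \<open>The action of \<open>PC\<close> on germs; by \<open>germ_act_cong\<close> the choice of
  representative is immaterial.\<close>

definition germ_rep :: "(circle \<Rightarrow> circle) set \<Rightarrow> circle \<times> bool \<Rightarrow> circle \<times> bool"
  where "germ_rep \<gamma> = germ_act (SOME f. f \<in> carrier PC_hat \<and> PC_proj f = \<gamma>)"

lemma germ_rep_proj: 
  assumes "f \<in> carrier PC_hat" shows "germ_rep (PC_proj f) = germ_act f"
proof -
  have "(SOME g. g \<in> carrier PC_hat \<and> PC_proj g = PC_proj f) \<in> carrier PC_hat \<and>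
      PC_proj (SOME g. g \<in> carrier PC_hat \<and> PC_proj g = PC_proj f) = PC_proj f"
    by (rule someI[of _ f]) (use assms in simp)
  then show ?thesis unfolding germ_rep_def using germ_act_cong assms by blast
qed

lemma PC_cases:
  assumes "\<gamma> \<in> carrier PC" obtains f where "f \<in> carrier PC_hat" "\<gamma> = PC_proj f"
  using assms PC_proj_surj by blast

lemma germ_rep_hom: "germ_rep \<in> hom PC (BijGroup UNIV)"
proof (rule homI)
  show "germ_rep \<gamma> \<in> carrier (BijGroup UNIV)" if "\<gamma> \<in> carrier PC" for \<gamma>
    using that by (elim PC_cases) (simp add: germ_rep_proj germ_act_bij BijGroup_def Bij_def)
  show "germ_rep (\<gamma> \<otimes>\<^bsub>PC\<^esub> \<delta>) = germ_rep \<gamma> \<otimes>\<^bsub>BijGroup UNIV\<^esub> germ_rep \<delta>"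
    if \<gamma>: "\<gamma> \<in> carrier PC" and \<delta>: "\<delta> \<in> carrier PC" for \<gamma> \<delta>
  proof -
    obtain f where f: "f \<in> carrier PC_hat" "\<gamma> = PC_proj f" using \<gamma> by (rule PC_cases)
    obtain g where g: "g \<in> carrier PC_hat" "\<delta> = PC_proj g" using \<delta> by (rule PC_cases)
    have "\<gamma> \<otimes>\<^bsub>PC\<^esub> \<delta> = PC_proj (f \<otimes>\<^bsub>PC_hat\<^esub> g)" using hom_mult[OF PC_proj_hom f(1) g(1)] f g by simp
    moreover have "f \<otimes>\<^bsub>PC_hat\<^esub> g \<in> carrier PC_hat"
      by (rule monoid.m_closed[OF group.is_monoid[OF group_PC_hat] f(1) g(1)])
    ultimately have "germ_rep (\<gamma> \<otimes>\<^bsub>PC\<^esub> \<delta>) = germ_act f \<circ> germ_act g"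
      by (simp add: germ_rep_proj germ_act_comp mult_PC_hat f g)
    then show ?thesis using f g by (simp add: germ_rep_proj mult_BijGroup_UNIV germ_act_bij)
  qed
qed

theorem theorem1p10:
  fixes \<Gamma> :: "(circle \<Rightarrow> circle) set set"
  assumes "subgroup \<Gamma> PC"
    and "comm_group (PC\<lparr>carrier := \<Gamma>\<rparr>)"
    and "\<exists>A. finite A \<and> A \<subseteq> carrier PC \<and> \<Gamma> = generate PC A"
  shows "realizable \<Gamma>"
proof -
  obtain A where A: "finite A" "A \<subseteq> carrier PC" "\<Gamma> = generate PC A" using assms(3) by blast
  have sub: "\<gamma> \<in> carrier PC" if "\<gamma> \<in> \<Gamma>" for \<gamma> using subgroup.mem_carrier[OF assms(1) that] .
  interpret rep: group_hom PC "BijGroup UNIV" germ_rep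
    by (intro group_hom.intro group_hom_axioms.intro group_PC group_BijGroup germ_rep_hom)
  have rep_bij: "bij (germ_rep \<gamma>)" if "\<gamma> \<in> carrier PC" for \<gamma>
    using that by (elim PC_cases) (simp add: germ_rep_proj germ_act_bij)
  have rep_mult: "germ_rep (\<gamma> \<otimes>\<^bsub>PC\<^esub> \<delta>) = germ_rep \<gamma> \<circ> germ_rep \<delta>" if "\<gamma> \<in> \<Gamma>" "\<delta> \<in> \<Gamma>" for \<gamma> \<delta>
    using that sub by (simp add: mult_BijGroup_UNIV rep_bij)
  interpret near_double "germ_rep ` \<Gamma>" "germ_rep ` A"
  proof
    show "finite (germ_rep ` A)" using A(1) by simp
    show "germ_rep ` A \<subseteq> Bij UNIV" using A(2) rep_bij by (auto simp: Bij_def)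
    show "germ_rep ` \<Gamma> = generate (BijGroup UNIV) (germ_rep ` A)"
      unfolding A(3) by (rule rep.generate_img[OF A(2), symmetric])
  next
    fix f g d assume "f \<in> germ_rep ` \<Gamma>" "g \<in> germ_rep ` \<Gamma>"
    then obtain \<gamma> \<delta> where gd: "\<gamma> \<in> \<Gamma>" "\<delta> \<in> \<Gamma>" "f = germ_rep \<gamma>" "g = germ_rep \<delta>" by blast
    have "\<gamma> \<otimes>\<^bsub>PC\<^esub> \<delta> = \<delta> \<otimes>\<^bsub>PC\<^esub> \<gamma>"
      using comm_monoid.m_comm[OF comm_group.axioms(1)[OF assms(2)], of \<gamma> \<delta>] gd by simp
    then have "f \<circ> g = g \<circ> f" using rep_mult gd by metis
    then show "f (g d) = g (f d)" by (metis comp_apply)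
  next
    fix f assume "f \<in> germ_rep ` \<Gamma>"
    then obtain h where "h \<in> carrier PC_hat" "f = germ_act h"
      using sub by (metis PC_cases germ_rep_proj imageE)
    then show "finite {d. f (flip d) \<noteq> flip (f d)}" "finite {d. f d = flip d}"
      using finite_germ_act_not_flip finite_reversed by simp_all
  qed
  obtain \<rho> where \<rho>: "\<And>f. f \<in> germ_rep ` \<Gamma> \<Longrightarrow> bij (\<rho> f)"
    "\<And>f g. f \<in> germ_rep ` \<Gamma> \<Longrightarrow> g \<in> germ_rep ` \<Gamma> \<Longrightarrow> \<rho> (f \<circ> g) = \<rho> f \<circ> \<rho> g"
    "\<And>f. f \<in> germ_rep ` \<Gamma> \<Longrightarrow> finite {p. \<rho> f p \<noteq> fst (f (p, True))}"
    using near_double_realization by blast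
  \<comment> \<open>\<open>R\<close> will be a homomorphic section of \<open>PC_proj\<close> over
    \<open>\<Gamma>\<close>, and its image is the subgroup that \<open>realizable\<close> asks
    for.\<close>
  define R where "R \<gamma> = \<rho> (germ_rep \<gamma>)" for \<gamma>
  have R: "R \<gamma> \<in> carrier PC_hat" "PC_proj (R \<gamma>) = \<gamma>" if \<gamma>: "\<gamma> \<in> \<Gamma>" for \<gamma>
  proof -
    obtain f where f: "f \<in> carrier PC_hat" "\<gamma> = PC_proj f" using sub[OF \<gamma>] by (rule PC_cases)
    obtain F where F: "finite F" "\<And>x. x \<notin> F \<Longrightarrow> isCont f x" using f(1) unfolding carrier_PC_hat by blast
    have rep: "germ_rep \<gamma> = germ_act f" by (simp add: f germ_rep_proj)
    \<comment> \<open>Off \<open>F\<close> the base point of the image germ is the value of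
      \<open>f\<close>, so only the exceptions of \<open>\<rho>\<close> remain.\<close>
    have "{x. R \<gamma> x \<noteq> f x} \<subseteq> F \<union> {p. \<rho> (germ_rep \<gamma>) p \<noteq> fst (germ_rep \<gamma> (p, True))}"
    proof
      fix x assume "x \<in> {x. R \<gamma> x \<noteq> f x}"
      then show "x \<in> F \<union> {p. \<rho> (germ_rep \<gamma>) p \<noteq> fst (germ_rep \<gamma> (p, True))}"
        using F(2)[of x] fst_germ_act[OF f(1), of x True] by (auto simp: R_def rep)
    qed
    moreover have "finite (F \<union> {p. \<rho> (germ_rep \<gamma>) p \<noteq> fst (germ_rep \<gamma> (p, True))})"
      using F(1) \<rho>(3) \<gamma> by blast
    ultimately have "finite {x. R \<gamma> x \<noteq> f x}" by (rule finite_subset)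
    moreover have "bij (R \<gamma>)" unfolding R_def using \<rho>(1) \<gamma> by blast
    ultimately show "R \<gamma> \<in> carrier PC_hat" "PC_proj (R \<gamma>) = \<gamma>"
      using PC_proj_eqI[OF f(1)] f(2) by blast+
  qed
  have "R \<in> hom (PC\<lparr>carrier := \<Gamma>\<rparr>) PC_hat"
  proof (rule homI)
    fix \<gamma> \<delta> assume "\<gamma> \<in> carrier (PC\<lparr>carrier := \<Gamma>\<rparr>)" "\<delta> \<in> carrier (PC\<lparr>carrier := \<Gamma>\<rparr>)"
    then have gd: "\<gamma> \<in> \<Gamma>" "\<delta> \<in> \<Gamma>" by simp_all
    have "R (\<gamma> \<otimes>\<^bsub>PC\<^esub> \<delta>) = R \<gamma> \<circ> R \<delta>"
      unfolding R_def rep_mult[OF gd] using \<rho>(2) gd by blast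
    then show "R (\<gamma> \<otimes>\<^bsub>PC\<lparr>carrier := \<Gamma>\<rparr>\<^esub> \<delta>) = R \<gamma> \<otimes>\<^bsub>PC_hat\<^esub> R \<delta>"
      by (simp add: mult_PC_hat R gd)
  qed (simp add: R)
  then interpret R: group_hom "PC\<lparr>carrier := \<Gamma>\<rparr>" PC_hat R
    by (intro group_hom.intro group_hom_axioms.intro group_PC_hat
        subgroup.subgroup_is_group[OF assms(1) group_PC])
  have "subgroup (R ` \<Gamma>) PC_hat" using R.img_is_subgroup by simp
  moreover have "bij_betw PC_proj (R ` \<Gamma>) \<Gamma>"
    by (rule bij_betw_byWitness[of _ R]) (use R in auto)
  ultimately show ?thesis unfolding realizable_def by blast
qed

end
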